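(* For every partition $\nu$, in the quotient algebra $\mathcal{U}/I^{\mathrm{kron}}$ one has \[ \mathfrak{J}_{\nu}(\mathbf{u}) = \sum_{T \in CT_{\nu}^<} \mathrm{sqread}(T). \]
   Context: Fix a positive integer $N$. Let $\mathcal{A}_\varnothing=\{1,\dots,N\}$ (unbarred letters), $\mathcal{A}_{\circ}=\{\bar 1,\dots,\bar N\}$ (barred letters), and $\mathcal{A}=\mathcal{A}_\varnothing\sqcup\mathcal{A}_\circ$. A colored word is a finite word in $\mathcal{A}$. The natural order $<$ on $\mathcal{A}$ is $1<\bar1<2<\bar2<\cdots<N<\bar N$. Let $\mathcal{U}$ be the free associative $\mathbb{Z}$-algebra on noncommuting variables $u_x$, $x\in\mathcal{A}$; its monomials are identified with colored words ($u_{w_1}\cdots u_{w_t}\leftrightarrow w_1\cdots w_t$). For $x\in\mathcal{A}$ define $x{\Downarrow}$ by $a{\Downarrow}=\overline{a-1}$ for $a\in\{2,\dots,N\}$ and $\bar a{\Downarrow}=a$ for $a\in\{1,\dots,N\}$ ($1{\Downarrow}$ is undefined). $I^{\mathrm{kron}}$ is the two-sided ideal of $\mathcal{U}$ generated by the following differences of colored words: $yyx-yxy$ ($x\in\mathcal{A}$, $y$ unbarred, $x<y$); $zyy-yzy$ ($z\in\mathcal{A}$, $y$ unbarred, $y<z$); $yyz-yzy$ ($z\in\mathcal{A}$, $y$ barred, $y<z$); $xyy-yxy$ ($x\in\mathcal{A}$, $y$ barred, $x<y$); $(xz-zx)y-y(xz-zx)$ for $x,y,z\in\mathcal{A}$ with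 $x=y{\Downarrow}=z{\Downarrow}{\Downarrow}$; and $xz-zx$ for $x,z\in\mathcal{A}$ such that $z{\Downarrow}{\Downarrow}$ is defined and $x<z{\Downarrow}{\Downarrow}$. For $x,y\in\mathcal{A}$ write $y \succeq_{\mathrm{col}} x$ if $y>x$ or $x,y$ are equal barred letters. For $k\ge1$ let $e_k(\mathbf{u})=\sum u_{z_1}u_{z_2}\cdots u_{z_k}$, summed over $z_1,\dots,z_k\in\mathcal{A}$ with $z_1\succeq_{\mathrm{col}}z_2\succeq_{\mathrm{col}}\cdots\succeq_{\mathrm{col}}z_k$; $e_0(\mathbf{u})=1$, $e_k(\mathbf{u})=0$ for $k<0$. For a partition $\nu$ with conjugate $\nu'$ having $t=\nu_1$ parts, the noncommutative super Schur function is $\mathfrak{J}_\nu(\mathbf{u})=\sum_{\pi\in S_t}\mathrm{sgn}(\pi)\,e_{\nu'_1+\pi(1)-1}(\mathbf{u})e_{\nu'_2+\pi(2)-2}(\mathbf{u})\cdots e_{\nu'_t+\pi(t)-t}(\mathbf{u})\in\mathcal{U}$. A $<$-colored tableau of shape $\nu$ is a filling of the Young diagram of $\nu$ (English convention) with letters of $\mathcal{A}$ such that rows and columns weakly increase with respect to $<$, unbarred letters strictly increase down each column and barred letters strictly increase along each row; $CT^<_\nu$ is the set of these. For such $T$, let $D^1,\dots,D^k$ be its diagonals (sets of boxes with constant column minus row), ordered starting from the southwest; let $w^i$ be the unbarred entries of $D^i$ read in the northwest direction followed by the barred entries of $D^i$ read in the southeast direction; $\mathrm{sqread}(T)=w^1w^2\cdots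 w^k$. *)

theory Defs
  imports
    "HOL-Combinatorics.Permutations"
    "HOL-Library.Poly_Mapping"
    "HOL-Library.FuncSet"
    "HOL-Algebra.QuotRing"
begin

text \<open>\<open>Bar a\<close> is the barred letter usually written with a bar over the number \<open>a\<close>. The type
  contains letters with arbitrary indices; \<open>alphabet N\<close> cuts out the \<open>2 N\<close> actual letters.\<close>

datatype letter = Unb nat | Bar nat

primrec is_barred :: "letter \<Rightarrow> bool" where
  "is_barred (Unb a) = False"
| "is_barred (Bar a) = True"

primrec letter_pos :: "letter \<Rightarrow> nat" where
  "letter_pos (Unb a) = 2 * a"
| "letter_pos (Bar a) = Suc (2 * a)"

lemma letter_pos_inject: "letter_pos x = letter_pos y \<longleftrightarrow> x = y"
  by (cases x; cases y) (simp_all, presburger+)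

text \<open>The natural order \<open>1 < Bar 1 < 2 < Bar 2 < \<dots>\<close>\<close>

instantiation letter :: linorder
begin

definition less_eq_letter :: "letter \<Rightarrow> letter \<Rightarrow> bool" where
  "x \<le> y \<longleftrightarrow> letter_pos x \<le> letter_pos y"

definition less_letter :: "letter \<Rightarrow> letter \<Rightarrow> bool" where
  "x < y \<longleftrightarrow> letter_pos x < letter_pos y"

instance
  by standard (auto simp: less_eq_letter_def less_letter_def letter_pos_inject)

end

definition alphabet :: "nat \<Rightarrow> letter set" where
  "alphabet N = Unb ` {1..N} \<union> Bar ` {1..N}"

text \<open>\<open>None\<close> means undefined.\<close>

fun down :: "letter \<Rightarrow> letter option" where
  "down (Unb a) = (if a \<ge> 2 then Some (Bar (a - 1)) else None)"
| "down (Bar a) = Some (Unb a)"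

definition down2 :: "letter \<Rightarrow> letter option" where
  "down2 x = Option.bind (down x) down"

text \<open>Lists form a monoid under concatenation. It is written additively because the
  convolution product of \<open>Poly_Mapping\<close> is based on an additive monoid of exponents; with
  this instance \<open>letter list \<Rightarrow>\<^sub>0 int\<close> is the (noncommutative) monoid ring of the free monoid
  on the letters.\<close>

instantiation list :: (type) monoid_add
begin

definition zero_list :: "'a list" where "zero_list = []"

definition plus_list :: "'a list \<Rightarrow> 'a list \<Rightarrow> 'a list" where "plus_list xs ys = xs @ ys"

instance
  by standard (simp_all add: zero_list_def plus_list_def)

end

type_synonym ncpoly = "letter list \<Rightarrow>\<^sub>0 int"

definition word :: "letter list \<Rightarrow> ncpoly" where
  "word w = Poly_Mapping.single w 1"

lemma word_mult: "word v * word w = word (v @ w)"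
  by (simp add: word_def mult_single plus_list_def)

lemma word_Nil: "word [] = 1"
  by (simp add: word_def flip: zero_list_def)

definition free_alg :: "nat \<Rightarrow> ncpoly ring" where
  "free_alg N = \<lparr>carrier = {p. Poly_Mapping.keys p \<subseteq> lists (alphabet N)},
     mult = (*), one = 1, zero = 0, add = (+)\<rparr>"

lemma ring_free_alg: "ring (free_alg N)"
proof -
  let ?C = "{p::ncpoly. Poly_Mapping.keys p \<subseteq> lists (alphabet N)}"
  have add: "p + q \<in> ?C" if "p \<in> ?C" "q \<in> ?C" for p q
    using that keys_add[of p q] by blast
  have mult: "p * q \<in> ?C" if pq: "p \<in> ?C" "q \<in> ?C" for p q
  proof -
    have "w \<in> lists (alphabet N)" if w: "w \<in> Poly_Mapping.keys (p * q)" for w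
    proof -
      from subsetD[OF keys_mult w] obtain a b
        where ab: "w = a @ b" "a \<in> Poly_Mapping.keys p" "b \<in> Poly_Mapping.keys q"
        by (auto simp: plus_list_def)
      then have "a \<in> lists (alphabet N)" "b \<in> lists (alphabet N)"
        using pq by (simp_all add: subset_iff)
      then show ?thesis using ab(1) by simp
    qed
    then show ?thesis by (simp add: subset_iff)
  qed
  have one: "1 \<in> ?C"
    unfolding word_Nil[symmetric] by (simp add: word_def)
  have neg: "- p \<in> ?C" if "p \<in> ?C" for p
    using that by simp
  show ?thesis
  proof (rule ringI)
    show "abelian_group (free_alg N)"
    proof (rule abelian_groupI)
      fix p assume "p \<in> carrier (free_alg N)"
      then show "\<exists>q\<in>carrier (free_alg N). q \<oplus>\<^bsub>free_alg N\<^esub> p = \<zero>\<^bsub>free_alg N\<^esub>"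
        using neg by (intro bexI[of _ "- p"]) (simp_all add: free_alg_def)
    qed (use add in \<open>simp_all add: free_alg_def ac_simps\<close>)
    show "Group.monoid (free_alg N)"
      by (rule monoidI) (use mult one in \<open>simp_all add: free_alg_def mult.assoc\<close>)
  qed (simp_all add: free_alg_def distrib_left distrib_right)
qed

lemma word_in_free_alg: "w \<in> lists (alphabet N) \<Longrightarrow> word w \<in> carrier (free_alg N)"
  by (simp add: word_def free_alg_def)

definition kron_gens :: "nat \<Rightarrow> ncpoly set" where
  "kron_gens N =
     {word [y, y, x] - word [y, x, y] | x y.
        x \<in> alphabet N \<and> y \<in> alphabet N \<and> \<not> is_barred y \<and> x < y}
   \<union> {word [z, y, y] - word [y, z, y] | y z.
        y \<in> alphabet N \<and> z \<in> alphabet N \<and> \<not> is_barred y \<and> y < z}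
   \<union> {word [y, y, z] - word [y, z, y] | y z.
        y \<in> alphabet N \<and> z \<in> alphabet N \<and> is_barred y \<and> y < z}
   \<union> {word [x, y, y] - word [y, x, y] | x y.
        x \<in> alphabet N \<and> y \<in> alphabet N \<and> is_barred y \<and> x < y}
   \<union> {(word [x, z] - word [z, x]) * word [y] - word [y] * (word [x, z] - word [z, x]) | x y z.
        x \<in> alphabet N \<and> y \<in> alphabet N \<and> z \<in> alphabet N \<and>
        down y = Some x \<and> down2 z = Some x}
   \<union> {word [x, z] - word [z, x] | x z.
        x \<in> alphabet N \<and> z \<in> alphabet N \<and> (\<exists>v. down2 z = Some v \<and> x < v)}"

definition I_kron :: "nat \<Rightarrow> ncpoly set" where
  "I_kron N = Idl\<^bsub>free_alg N\<^esub> (kron_gens N)"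

lemma kron_gens_carrier: "kron_gens N \<subseteq> carrier (free_alg N)"
proof -
  have diff: "p - q \<in> carrier (free_alg N)"
    if "p \<in> carrier (free_alg N)" "q \<in> carrier (free_alg N)" for p q
    using that keys_diff[of p q] by (auto simp: free_alg_def)
  show ?thesis
    unfolding kron_gens_def
    by (auto simp: right_diff_distrib left_diff_distrib word_mult
             intro!: diff word_in_free_alg)
qed

lemma ideal_I_kron: "ideal (I_kron N) (free_alg N)"
  unfolding I_kron_def by (rule ring.genideal_ideal[OF ring_free_alg kron_gens_carrier])

definition is_partition :: "nat list \<Rightarrow> bool" where
  "is_partition \<nu> \<longleftrightarrow> sorted_wrt (\<ge>) \<nu> \<and> (\<forall>k\<in>set \<nu>. 0 < k)"

definition first_part :: "nat list \<Rightarrow> nat" where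
  "first_part \<nu> = (case \<nu> of [] \<Rightarrow> 0 | k # _ \<Rightarrow> k)"

text \<open>Rows and columns are numbered from \<open>0\<close>; \<open>conj_part \<nu> j\<close> is the length of column \<open>j\<close>.\<close>

definition conj_part :: "nat list \<Rightarrow> nat \<Rightarrow> nat" where
  "conj_part \<nu> j = card {i. i < length \<nu> \<and> j < \<nu> ! i}"

definition succeq_col :: "letter \<Rightarrow> letter \<Rightarrow> bool" where
  "succeq_col y x \<longleftrightarrow> y > x \<or> (x = y \<and> is_barred x)"

definition e_nc :: "nat \<Rightarrow> int \<Rightarrow> ncpoly" where
  "e_nc N k = (if k < 0 then 0 else
     (\<Sum>w | w \<in> lists (alphabet N) \<and> length w = nat k \<and> successively succeq_col w. word w))"

text \<open>Numbering columns from \<open>0\<close> also shifts the permutations to \<open>{0..<t}\<close>, which leaves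
  \<open>\<pi> j - j\<close> unchanged. \<open>prod_list\<close> keeps the order of the noncommuting factors.\<close>

definition super_schur :: "nat \<Rightarrow> nat list \<Rightarrow> ncpoly" where
  "super_schur N \<nu> = (let t = first_part \<nu> in
     \<Sum>\<pi> | \<pi> permutes {0..<t}.
       of_int (sign \<pi>) *
       prod_list (map (\<lambda>j. e_nc N (int (conj_part \<nu> j) + int (\<pi> j) - int j)) [0..<t]))"

text \<open>Boxes are pairs (row, column), rows going downwards.\<close>

definition diagram :: "nat list \<Rightarrow> (nat \<times> nat) set" where
  "diagram \<nu> = {(r, c). r < length \<nu> \<and> c < \<nu> ! r}"

text \<open>Fillings are extensional functions, so that each tableau is counted once.\<close>

definition colored_tableaux :: "nat \<Rightarrow> nat list \<Rightarrow> (nat \<times> nat \<Rightarrow> letter) set" where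
  "colored_tableaux N \<nu> = {T \<in> diagram \<nu> \<rightarrow>\<^sub>E alphabet N.
     (\<forall>r c c'. (r, c) \<in> diagram \<nu> \<and> (r, c') \<in> diagram \<nu> \<and> c < c' \<longrightarrow>
        T (r, c) \<le> T (r, c') \<and>
        (is_barred (T (r, c)) \<and> is_barred (T (r, c')) \<longrightarrow> T (r, c) < T (r, c'))) \<and>
     (\<forall>r r' c. (r, c) \<in> diagram \<nu> \<and> (r', c) \<in> diagram \<nu> \<and> r < r' \<longrightarrow>
        T (r, c) \<le> T (r', c) \<and>
        (\<not> is_barred (T (r, c)) \<and> \<not> is_barred (T (r', c)) \<longrightarrow> T (r, c) < T (r', c)))}"

text \<open>The boxes with column minus row equal to \<open>d\<close>, listed in the southeast direction\<close>

definition diagonal :: "nat list \<Rightarrow> int \<Rightarrow> (nat \<times> nat) list" where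
  "diagonal \<nu> d = map (\<lambda>r. (r, nat (int r + d)))
     (filter (\<lambda>r. 0 \<le> int r + d \<and> (r, nat (int r + d)) \<in> diagram \<nu>) [0..<length \<nu>])"

definition diag_word :: "nat list \<Rightarrow> (nat \<times> nat \<Rightarrow> letter) \<Rightarrow> int \<Rightarrow> letter list" where
  "diag_word \<nu> T d =
     filter (\<lambda>x. \<not> is_barred x) (rev (map T (diagonal \<nu> d))) @
     filter is_barred (map T (diagonal \<nu> d))"

text \<open>The diagonals from the southwest corner, of content \<open>1 - length \<nu>\<close>, to the northeast one\<close>

definition sqread :: "nat list \<Rightarrow> (nat \<times> nat \<Rightarrow> letter) \<Rightarrow> letter list" where
  "sqread \<nu> T = concat (map (diag_word \<nu> T) [1 - int (length \<nu>)..int (first_part \<nu>) - 1])"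

end

theory Submission
  imports Defs
begin

text \<open>The elementary functions in the letters of index at most \<open>i\<close> commute in the quotient, so a
  determinant vanishes if two adjacent rows use the same \<open>i\<close> and the same shift. Allow a bound \<open>i\<close>
  for each column of the shape and expand every column that meets the next diagonal (starting
  from the southwest) by its leading letter, the columns being treated from right to left: the
  terms in which the new letter is too small for its left neighbour combine to a determinant
  with two equal rows, and the remaining letters are exactly the admissible entries of the diagonal.
  An unbarred letter can then be moved to the front, because it crosses a row only up to terms that
  cancel in the antisymmetrization. Once the whole diagonal is extracted, its barred letters can be
  moved to the front term by term. This produces the diagonal in the order of \<open>sqread\<close> times a determinant
  for the shape without the diagonal, with new bounds.\<close>

section \<open>Elementary symmetric functions in the quotient algebra\<close>

text \<open>Barred and unbarred letters cross a row for opposite reasons, and this fixes the order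
  of the extraction. Carrying \<open>Unb (Suc i)\<close> across \<open>e i\<close> leaves a
  correction that cancels after antisymmetrizing with a still unexpanded row of bound
  \<open>i\<close>. So a column is expanded while all columns to its left are intact, and unbarred
  letters come out towards the northwest. Carrying \<open>Bar (Suc i)\<close> across
  \<open>e i\<close> leaves a correction annihilated by \<open>Bar i\<close> on its left. This helps
  only after the left column has been expanded: if its leading letter is the largest one allowed,
  \<open>Bar i\<close>, that letter annihilates the correction; otherwise the rest of its row has a
  smaller bound and commutes with \<open>Bar (Suc i)\<close>. So barred letters wait, and come out
  towards the southeast.

  The bounds encode the tableau built so far: for a new box, the bound of its column is the flag of
  the box below, if there is one, and the bound of the preceding column is the flag of the left
  neighbour.\<close>

primrec idx :: "letter \<Rightarrow> nat" where
  "idx (Unb a) = a"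
| "idx (Bar a) = a"

lemma Collect_idx: "{x. P (idx x)} = Unb ` {a. P a} \<union> Bar ` {a. P a}"
proof (rule Set.set_eqI)
  show "x \<in> {x. P (idx x)} \<longleftrightarrow> x \<in> Unb ` {a. P a} \<union> Bar ` {a. P a}" for x
    by (cases x) auto
qed

lemma finite_idx_le [simp]: "finite {x. l < idx x \<and> idx x \<le> h}"
proof -
  have "{a. l < a \<and> a \<le> h} = {l<..h}" by auto
  then show ?thesis by (simp add: Collect_idx[of "\<lambda>a. l < a \<and> a \<le> h"])
qed

text \<open>A letter \<open>v\<close> followed in the same row by \<open>y\<close> requires \<open>flag v < idx y\<close>, and a letter \<open>z\<close>
  standing above \<open>v\<close> in the same column requires \<open>idx z \<le> flag v\<close>.\<close>

primrec flag :: "letter \<Rightarrow> nat" where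
  "flag (Unb a) = a - 1"
| "flag (Bar a) = a"

text \<open>Recursion on the leading letter of a column word: after \<open>Unb (Suc i)\<close> only
  indices up to \<open>i\<close> follow, while \<open>Bar (Suc i)\<close> may repeat. In generating
  functions, E_{i+1}(t) = (1 - t B)^{-1} (1 + t U) E_i(t), where U and B are the letters of index i
  + 1; the commutation proofs follow this factorization.\<close>

fun esf_nat :: "(letter \<Rightarrow> 'r::ring_1) \<Rightarrow> nat \<Rightarrow> nat \<Rightarrow> 'r" where
  "esf_nat u 0 k = (if k = 0 then 1 else 0)"
| "esf_nat u (Suc i) 0 = 1"
| "esf_nat u (Suc i) (Suc k) =
     esf_nat u i (Suc k) + u (Unb (Suc i)) * esf_nat u i k + u (Bar (Suc i)) * esf_nat u (Suc i) k"

definition esf :: "(letter \<Rightarrow> 'r::ring_1) \<Rightarrow> nat \<Rightarrow> int \<Rightarrow> 'r" where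
  "esf u i k = (if k < 0 then 0 else esf_nat u i (nat k))"

lemma esf_neg: "k < 0 \<Longrightarrow> esf u i k = 0"
  by (simp add: esf_def)

lemma esf_0: "esf u 0 k = (if k = 0 then 1 else 0)"
  by (simp add: esf_def)

lemma esf_zero: "esf u i 0 = 1"
  by (cases i) (simp_all add: esf_def)

lemma esf_Suc:
  "esf u (Suc i) k = esf u i k + u (Unb (Suc i)) * esf u i (k - 1) + u (Bar (Suc i)) * esf u (Suc i) (k - 1)"
proof (cases "k \<le> 0")
  case True
  then show ?thesis by (cases "k = 0") (simp_all add: esf_neg esf_zero)
next
  case False
  then have "nat k = Suc (nat (k - 1))" by simp
  with False show ?thesis by (simp add: esf_def del: nat_diff_distrib')
qed

section \<open>Commutation of generating functions\<close>

lemma int_pred_induct: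
  fixes k :: int
  assumes "\<And>k. k < 0 \<Longrightarrow> P k" and "\<And>k. P (k - 1) \<Longrightarrow> P k"
  shows "P k"
proof (cases "k < 0")
  case False
  then have "-1 \<le> k" by simp
  then show ?thesis
  proof (induction k rule: int_ge_induct)
    case (step i)
    then show ?case using assms(2)[of "i + 1"] by simp
  qed (simp add: assms(1))
qed (rule assms(1))

text \<open>For the generating function \<open>H(t) = (1 - t p)\<inverse> F(t)\<close>, the relations \<open>F(t) p = (p + t q) F(t)\<close>
  and \<open>q p = 0\<close> give \<open>H(t) H(s) = Q\<inverse> F(t) F(s)\<close>, where \<open>Q = 1 - (s + t) p + s t p\<^sup>2 - s t q\<close> is
  symmetric in \<open>s\<close> and \<open>t\<close>. The proof compares coefficients.\<close>

lemma commute_geometric_factor: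
  fixes f h :: "int \<Rightarrow> 'r::ring_1"
  assumes h: "\<And>k. h k = f k + p * h (k - 1)" and h_neg: "\<And>k. k < 0 \<Longrightarrow> h k = 0"
    and fp: "\<And>k. f k * p = p * f k + q * f (k - 1)" and qp: "q * p = 0"
    and ff: "\<And>k l. f k * f l = f l * f k"
  shows "h k * h l = h l * h k"
proof (induction "nat (k + l)" arbitrary: k l rule: less_induct)
  case less
  define C where "C k l = h k * h l - h l * h k" for k l
  have f: "f k = h k - p * h (k - 1)" for k by (simp add: h[of k])
  have fph: "f k * (p * x) = p * (f k * x) + q * (f (k - 1) * x)" for k x
    by (simp add: mult.assoc[symmetric] fp) (simp add: algebra_simps)
  have qpx: "q * (p * x) = 0" for x by (simp add: mult.assoc[symmetric] qp)
  \<comment> \<open>The coefficient of t^k s^l in F(t) F(s) = Q H(t) H(s); \<open>q * p = 0\<close>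
    removes the only term that is not symmetric in s and t.\<close>
  have expand: "f k * f l = h k * h l - p * (h (k - 1) * h l) - p * (h k * h (l - 1))
      + p * (p * (h (k - 1) * h (l - 1))) - q * (h (k - 1) * h (l - 1))" for k l
  proof -
    have "f k * f l = f k * h l - f k * (p * h (l - 1))" by (simp add: f[of l] algebra_simps)
    also have "\<dots> = f k * h l - p * (f k * h (l - 1)) - q * (f (k - 1) * h (l - 1))"
      by (simp add: fph algebra_simps)
    also have "\<dots> = h k * h l - p * (h (k - 1) * h l) - p * (h k * h (l - 1))
      + p * (p * (h (k - 1) * h (l - 1))) - q * (h (k - 1) * h (l - 1))"
      by (simp add: f algebra_simps qpx)
    finally show ?thesis .
  qed
  have IH: "h k' * h l' = h l' * h k'" if "k' + l' < k + l" "k' \<le> k" "l' \<le> l" "0 \<le> k" "0 \<le> l" for k' l'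
  proof (cases "k' < 0 \<or> l' < 0")
    case True then show ?thesis by (auto simp: h_neg)
  next
    case False then show ?thesis using less[of k' l'] that by simp
  qed
  show ?case
  proof (cases "k < 0 \<or> l < 0")
    case True then show ?thesis by (auto simp: h_neg)
  next
    case False
    then have k: "0 \<le> k" "0 \<le> l" by auto
    \<comment> \<open>Every product in \<open>expand\<close> except the leading one has smaller
      total degree, so exchanging \<open>k\<close> and \<open>l\<close> can only affect the leading
      one.\<close>
    have "h (k - 1) * h l = h l * h (k - 1)" "h k * h (l - 1) = h (l - 1) * h k"
      "h (k - 1) * h (l - 1) = h (l - 1) * h (k - 1)"
      by (rule IH; use k in simp)+
    then show ?thesis using expand[of k l] expand[of l k] ff[of k l] by (simp add: algebra_simps)
  qed
qed

text \<open>For G(t) = (1 + t b) E(t), the relations E(t) b = (b + t q) E(t) and b q = 0 give G(t)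
  G(s) = (1 + (s + t) b + s t (b^2 + q)) E(t) E(s), which is symmetric in s and t.\<close>

lemma commute_linear_factor:
  fixes e :: "int \<Rightarrow> 'r::ring_1"
  assumes eb: "\<And>k. e k * b = b * e k + q * e (k - 1)" and bq: "b * q = 0"
    and ee: "\<And>k l. e k * e l = e l * e k"
  shows "(e k + b * e (k - 1)) * (e l + b * e (l - 1)) = (e l + b * e (l - 1)) * (e k + b * e (k - 1))"
proof -
  have ebx: "e k * (b * x) = b * (e k * x) + q * (e (k - 1) * x)" for k x
    by (simp add: mult.assoc[symmetric] eb) (simp add: algebra_simps)
  have bqx: "b * (q * x) = 0" for x by (simp add: mult.assoc[symmetric] bq)
  have "(e k + b * e (k - 1)) * (e l + b * e (l - 1)) = e k * e l + b * (e (k - 1) * e l + e k * e (l - 1))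
      + q * (e (k - 1) * e (l - 1)) + b * (b * (e (k - 1) * e (l - 1)))" for k l
    by (simp add: algebra_simps ebx bqx)
  from this[of k l] this[of l k] show ?thesis
    by (simp add: ee[of l] ee[of "l - 1"] add.commute)
qed

text \<open>The relations of the ideal, read in an arbitrary ring. With vanishing letters of index
  0, formulas that involve the indices \<open>i\<close> and \<open>Suc i\<close> remain valid at
  \<open>i = 0\<close>.\<close>

locale kron_letters =
  fixes u :: "letter \<Rightarrow> 'r::ring_1"
  assumes zero_Unb: "u (Unb 0) = 0" and zero_Bar: "u (Bar 0) = 0"
    and unb_gt: "\<And>x y. \<not> is_barred y \<Longrightarrow> x < y \<Longrightarrow> u y * (u y * u x) = u y * (u x * u y)"
    and unb_lt: "\<And>y z. \<not> is_barred y \<Longrightarrow> y < z \<Longrightarrow> u z * (u y * u y) = u y * (u z * u y)"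
    and bar_lt: "\<And>y z. is_barred y \<Longrightarrow> y < z \<Longrightarrow> u y * (u y * u z) = u y * (u z * u y)"
    and bar_gt: "\<And>x y. is_barred y \<Longrightarrow> x < y \<Longrightarrow> u x * (u y * u y) = u y * (u x * u y)"
    and near: "\<And>x y z. down y = Some x \<Longrightarrow> down2 z = Some x \<Longrightarrow>
      (u x * u z - u z * u x) * u y = u y * (u x * u z - u z * u x)"
    and far: "\<And>x z v. down2 z = Some v \<Longrightarrow> x < v \<Longrightarrow> u x * u z = u z * u x"
begin

abbreviation U :: "nat \<Rightarrow> 'r" where "U a \<equiv> u (Unb a)"
abbreviation B :: "nat \<Rightarrow> 'r" where "B a \<equiv> u (Bar a)"
abbreviation e :: "nat \<Rightarrow> int \<Rightarrow> 'r" where "e \<equiv> esf u"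

lemma far_commute: "idx x + 2 \<le> idx z \<Longrightarrow> u x * u z = u z * u x"
  by (rule far[of z "case z of Unb a \<Rightarrow> Unb (a - 1) | Bar a \<Rightarrow> Bar (a - 1)"])
    (cases x; cases z; auto simp: down2_def less_letter_def)+

text \<open>Among letters of adjacent positive indices this is the only pair that \<open>far\<close>
  reaches, because \<open>down2 (Bar (Suc i)) = Some (Bar i)\<close> lies above
  \<open>Unb i\<close>.\<close>

lemma far_commute': "i < j \<Longrightarrow> U i * B j = B j * U i"
  by (cases "i = 0") (auto intro!: far[of _ "Bar (j - 1)"] simp: down2_def less_letter_def zero_Unb)

lemma esf_commute_letter:
  assumes "\<And>x. idx x \<le> i \<Longrightarrow> u x * y = y * u x"
  shows "e i k * y = y * e i k"
  using assms
proof (induction i arbitrary: k)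
  case 0
  then show ?case by (simp add: esf_0)
next
  case (Suc i)
  have IH: "e i k * y = y * e i k" for k by (rule Suc.IH) (simp add: Suc.prems)
  have IHx: "y * (e i k * x) = e i k * (y * x)" for k x by (simp add: mult.assoc[symmetric] IH)
  have U: "y * (U (Suc i) * x) = U (Suc i) * (y * x)" and B: "y * (B (Suc i) * x) = B (Suc i) * (y * x)" for x
    using Suc.prems[of "Unb (Suc i)"] Suc.prems[of "Bar (Suc i)"] by (simp_all add: mult.assoc[symmetric])
  show ?case
  proof (induction k rule: int_pred_induct)
    case (2 k)
    show ?case
      by (simp add: esf_Suc[of u i k] algebra_simps U B IH 2)
  qed (simp add: esf_neg)
qed

lemma esf_far: "i + 2 \<le> idx y \<Longrightarrow> e i k * u y = u y * e i k"
  by (rule esf_commute_letter, rule far_commute) simp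

text \<open>The generating function (1 + t U_i) E_{i-1}(t), that is, E_i(t) without its geometric
  factor for \<open>Bar i\<close>.\<close>

definition half :: "nat \<Rightarrow> int \<Rightarrow> 'r" where
  "half i k = (case i of 0 \<Rightarrow> e 0 k | Suc j \<Rightarrow> e j k + U i * e j (k - 1))"

lemma esf_half: "e i k = half i k + B i * e i (k - 1)"
  by (cases i) (simp_all add: half_def esf_Suc[of u _ k] zero_Bar)

lemma half_commute_Bar: "half i k * B (Suc i) = B (Suc i) * half i k"
proof (cases i)
  case 0
  then show ?thesis by (simp add: half_def esf_0)
next
  case (Suc j)
  have E: "e j k * B (Suc i) = B (Suc i) * e j k" for k by (rule esf_far) (simp add: Suc)
  have "B (Suc i) * (U i * x) = U i * (B (Suc i) * x)" for x
    using far_commute'[of i "Suc i"] by (simp add: mult.assoc[symmetric])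
  then show ?thesis by (simp add: half_def Suc E[unfolded Suc] algebra_simps)
qed

lemma half_Unb:
  "half i k * U (Suc i) = U (Suc i) * half i k + (U i * U (Suc i) - U (Suc i) * U i) * half i (k - 1)"
proof (cases i)
  case 0
  then show ?thesis by (simp add: half_def esf_0 zero_Unb)
next
  case (Suc j)
  let ?a = "U i" and ?b = "U (Suc i)"
  have E: "e j k * ?b = ?b * e j k" for k by (rule esf_far) (simp add: Suc)
  have "?a * (?b * ?a) = ?b * (?a * ?a)" using unb_lt[of "Unb i" "Unb (Suc i)"] by (simp add: less_letter_def)
  then have aba: "?a * (?b * (?a * x)) = ?b * (?a * (?a * x))" for x by (metis mult.assoc)
  show ?thesis by (simp add: half_def Suc[symmetric]) (simp add: Suc E[unfolded Suc] aba[unfolded Suc] algebra_simps)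
qed

text \<open>The commutator of \<open>U i + B i\<close> with \<open>U (Suc i)\<close>. Letters of
  index below \<open>i\<close> commute with \<open>U (Suc i)\<close> and contribute nothing.\<close>

definition kap :: "nat \<Rightarrow> 'r" where
  "kap i = U i * U (Suc i) - U (Suc i) * U i + B i * U (Suc i) - U (Suc i) * B i"

lemma U_kap: "U (Suc i) * kap i = 0"
proof -
  have "u (Unb (Suc i)) * (u (Unb (Suc i)) * u x) = u (Unb (Suc i)) * (u x * u (Unb (Suc i)))"
    if "x \<in> {Unb i, Bar i}" for x
    using that by (intro unb_gt) (auto simp: less_letter_def)
  then show ?thesis by (simp add: kap_def algebra_simps)
qed

text \<open>The generating function \<open>E(t)\<close> of \<open>e i\<close> satisfies \<open>E(t) b = (b + t kap) E(t)\<close>.\<close>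

lemma esf_Unb: "e i k * U (Suc i) = U (Suc i) * e i k + kap i * e i (k - 1)"
proof (induction k rule: int_pred_induct)
  case (2 k)
  let ?a = "U i" and ?A = "B i" and ?b = "U (Suc i)" and ?c = "U i * U (Suc i) - U (Suc i) * U i"
  have IH: "e i (k - 1) * ?b = ?b * e i (k - 1) + kap i * e i (k - 2)"
    using 2 by simp
  \<comment> \<open>The relation \<open>near\<close> for the consecutive letters
    \<open>Unb i\<close>, \<open>Bar i\<close>, \<open>Unb (Suc i)\<close>.\<close>
  have cA: "?c * ?A = ?A * ?c"
    by (cases "i = 0", simp add: zero_Bar zero_Unb, rule near) (simp_all add: down2_def)
  have "?A * (?A * ?b) = ?A * (?b * ?A)"
    by (rule bar_lt) (simp_all add: less_letter_def)
  \<comment> \<open>\<open>?A\<close> kills its own commutator with \<open>?b\<close> from the left,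
    so only the part \<open>?c\<close> of \<open>kap i\<close> survives, and \<open>?A\<close>
    commutes with it.\<close>
  then have "?A * kap i = ?c * ?A" by (simp only: cA) (simp add: kap_def algebra_simps)
  then have Akap: "?A * (kap i * x) = ?c * (?A * x)" for x by (metis mult.assoc)
  have "e i k * ?b = half i k * ?b + ?A * (e i (k - 1) * ?b)"
    by (subst esf_half) (simp add: algebra_simps)
  also have "\<dots> = ?b * half i k + ?c * half i (k - 1) + ?A * (?b * e i (k - 1)) + ?c * (?A * e i (k - 2))"
    by (simp only: half_Unb IH distrib_left Akap add.assoc)
  also have "\<dots> = ?b * half i k + ?c * e i (k - 1) + ?A * (?b * e i (k - 1))"
    by (simp add: esf_half[of i "k - 1"] algebra_simps)
  also have "\<dots> = ?b * e i k + kap i * e i (k - 1)"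
    by (simp add: esf_half[of i k] kap_def algebra_simps)
  finally show ?case .
qed (simp add: esf_neg)

lemma Bar_commutator: "B i * (B i * B (Suc i) - B (Suc i) * B i) = 0"
  "(B i * B (Suc i) - B (Suc i) * B i) * B (Suc i) = 0"
  using bar_lt[of "Bar i" "Bar (Suc i)"] bar_gt[of "Bar (Suc i)" "Bar i"]
  by (simp_all add: less_letter_def algebra_simps)

text \<open>Of the letters of index at most \<open>i\<close>, only \<open>Bar i\<close> can fail to
  commute with \<open>Bar (Suc i)\<close>. The correction does not accumulate along powers of
  \<open>B i\<close>, because \<open>B i\<close> kills the commutator from the left.\<close>

lemma esf_Bar:
  "e i k * B (Suc i) = B (Suc i) * e i k + (B i * B (Suc i) - B (Suc i) * B i) * e i (k - 1)"
proof (induction k rule: int_pred_induct)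
  case (2 k)
  let ?A = "B i" and ?b = "B (Suc i)" and ?c = "B i * B (Suc i) - B (Suc i) * B i"
  have IH: "e i (k - 1) * ?b = ?b * e i (k - 1) + ?c * e i (k - 2)"
    using 2 by simp
  have Ac: "?A * (?c * x) = 0" for x by (simp only: mult.assoc[symmetric] Bar_commutator) simp
  have "e i k * ?b = half i k * ?b + ?A * (e i (k - 1) * ?b)"
    by (subst esf_half) (simp add: algebra_simps)
  also have "\<dots> = ?b * half i k + ?A * (?b * e i (k - 1))"
    by (simp only: half_commute_Bar IH distrib_left Ac add_0_right)
  also have "\<dots> = ?b * e i k + ?c * e i (k - 1)"
    by (simp add: esf_half[of i k] algebra_simps)
  finally show ?case .
qed (simp add: esf_neg)

text \<open>A factor \<open>B i\<close> in front annihilates the correction of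
  \<open>esf_Bar\<close>. This lets a barred letter cross a row whose own leading letter is
  \<open>Bar i\<close>.\<close>

lemma Bar_esf_Bar: "B i * e i k * B (Suc i) = B i * B (Suc i) * e i k"
proof -
  have "B i * e i k * B (Suc i) = B i * B (Suc i) * e i k +
      (B i * (B i * B (Suc i) - B (Suc i) * B i)) * e i (k - 1)"
    by (simp only: mult.assoc esf_Bar distrib_left)
  then show ?thesis by (simp only: Bar_commutator) simp
qed

lemma half_Suc_Bar:
  "half (Suc i) k * B (Suc i) = B (Suc i) * half (Suc i) k +
   (U (Suc i) * B (Suc i) - B (Suc i) * U (Suc i) + (B i * B (Suc i) - B (Suc i) * B i)) * half (Suc i) (k - 1)"
proof -
  let ?b = "U (Suc i)" and ?bb = "B (Suc i)" and ?c = "B i * B (Suc i) - B (Suc i) * B i"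
  have "?bb * (?b * ?b) = ?b * (?bb * ?b)" by (rule unb_lt) (simp_all add: less_letter_def)
  then have 1: "?bb * (?b * (?b * x)) = ?b * (?bb * (?b * x))" for x by (metis mult.assoc)
  \<comment> \<open>The relation \<open>near\<close> for the consecutive letters
    \<open>Bar i\<close>, \<open>Unb (Suc i)\<close>, \<open>Bar (Suc i)\<close>.\<close>
  have "?c * ?b = ?b * ?c"
    by (cases "i = 0", simp add: zero_Bar, rule near) (simp_all add: down2_def)
  then have 2: "?b * (?c * x) = ?c * (?b * x)" for x by (metis mult.assoc)
  have "half (Suc i) k * ?bb = e i k * ?bb + ?b * (e i (k - 1) * ?bb)"
    by (simp add: half_def algebra_simps)
  also have "\<dots> = ?bb * e i k + ?c * e i (k - 1) + ?b * (?bb * e i (k - 1)) + ?c * (?b * e i (k - 2))"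
    by (simp only: esf_Bar distrib_left 2 add.assoc) simp
  also have "\<dots> = ?bb * half (Suc i) k + (?b * ?bb - ?bb * ?b + ?c) * half (Suc i) (k - 1)"
    by (simp add: half_def algebra_simps 1)
  finally show ?thesis .
qed

text \<open>Each increase of the index has two stages: the linear factor of the unbarred letter
  leads from \<open>e i\<close> to \<open>half (Suc i)\<close>, and the geometric factor of the
  barred letter leads from there to \<open>e (Suc i)\<close>.\<close>

lemma esf_commute: "e i k * e i l = e i l * e i k"
proof (induction i arbitrary: k l)
  case 0
  then show ?case by (simp add: esf_0)
next
  case (Suc i)
  let ?b = "U (Suc i)" and ?bb = "B (Suc i)"
  have "half (Suc i) k * half (Suc i) l = half (Suc i) l * half (Suc i) k" for k l
    unfolding half_def nat.case by (rule commute_linear_factor[where e = "e i" and q = "kap i", OF esf_Unb U_kap Suc])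
  moreover have "(?b * ?bb - ?bb * ?b + (B i * ?bb - ?bb * B i)) * ?bb = 0"
    using Bar_commutator(2)[of i] bar_gt[of "Bar (Suc i)" "Unb (Suc i)"]
    by (simp add: less_letter_def algebra_simps)
  ultimately show ?case
    by (intro commute_geometric_factor[where f = "half (Suc i)", OF esf_half esf_neg half_Suc_Bar])
qed

text \<open>In the antisymmetrization of two adjacent rows, the letter may be moved across the first one.\<close>

lemma esf_Unb_antisym:
  "e i p * U (Suc i) * e i (q - 1) - e i q * U (Suc i) * e i (p - 1) =
   U (Suc i) * e i p * e i (q - 1) - U (Suc i) * e i q * e i (p - 1)"
  by (simp add: esf_Unb algebra_simps esf_commute)

text \<open>A column word uses only indices up to \<open>l\<close>, or it starts with a letter
  \<open>x\<close> of larger index; the letters allowed after \<open>x\<close> are exactly those of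
  index at most \<open>flag x\<close>.\<close>

lemma esf_expand:
  assumes "l \<le> h"
  shows "e h k = e l k + (\<Sum>x | l < idx x \<and> idx x \<le> h. u x * e (flag x) (k - 1))"
  using assms
proof (induction h rule: dec_induct)
  case base
  have "{x. l < idx x \<and> idx x \<le> l} = {}" by auto
  then show ?case by (metis add.right_neutral sum.empty)
next
  case (step h)
  have "{x. l < idx x \<and> idx x \<le> Suc h} = insert (Unb (Suc h)) (insert (Bar (Suc h)) {x. l < idx x \<and> idx x \<le> h})"
  proof (rule Set.set_eqI)
    fix x
    show "x \<in> {x. l < idx x \<and> idx x \<le> Suc h} \<longleftrightarrow>
        x \<in> insert (Unb (Suc h)) (insert (Bar (Suc h)) {x. l < idx x \<and> idx x \<le> h})"
      using step.hyps by (cases x) auto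
  qed
  then show ?case by (simp add: esf_Suc[of u h k] step.IH algebra_simps)
qed

end

section \<open>Row-ordered determinants\<close>

definition ncdet :: "nat \<Rightarrow> (nat \<Rightarrow> nat \<Rightarrow> 'r::ring_1) \<Rightarrow> 'r" where
  "ncdet t c = (\<Sum>\<pi> | \<pi> permutes {0..<t}.
     of_int (sign \<pi>) * prod_list (map (\<lambda>j. c j (\<pi> j)) [0..<t]))"

lemma prod_list_upt_split:
  fixes f :: "nat \<Rightarrow> 'r::monoid_mult"
  assumes "j < t"
  shows "prod_list (map f [0..<t]) = prod_list (map f [0..<j]) * f j * prod_list (map f [Suc j..<t])"
proof -
  have "[0..<t] = [0..<j] @ j # [Suc j..<t]"
    using assms by (metis le_add1 less_imp_add_positive less_imp_le_nat plus_nat.add_0 upt_add_eq_append upt_conv_Cons zero_le)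
  then show ?thesis by (simp add: mult.assoc)
qed

lemma ncdet_row:
  assumes "j < t"
  shows "ncdet t (c(j := f)) = (\<Sum>\<pi> | \<pi> permutes {0..<t}. of_int (sign \<pi>) *
    (prod_list (map (\<lambda>k. c k (\<pi> k)) [0..<j]) * f (\<pi> j) * prod_list (map (\<lambda>k. c k (\<pi> k)) [Suc j..<t])))"
proof -
  have 1: "map (\<lambda>k. (c(j := f)) k (\<pi> k)) [0..<j] = map (\<lambda>k. c k (\<pi> k)) [0..<j]"
    and 2: "map (\<lambda>k. (c(j := f)) k (\<pi> k)) [Suc j..<t] = map (\<lambda>k. c k (\<pi> k)) [Suc j..<t]" for \<pi>
    by auto
  show ?thesis
    unfolding ncdet_def by (rule sum.cong[OF refl], subst prod_list_upt_split[OF assms], subst 1, subst 2) simp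
qed

lemma ncdet_row_add:
  assumes "j < t"
  shows "ncdet t (c(j := \<lambda>i. f i + g i)) = ncdet t (c(j := f)) + ncdet t (c(j := g))"
  unfolding ncdet_row[OF assms] by (simp add: sum.distrib[symmetric] algebra_simps)

lemma ncdet_row_sum:
  assumes "j < t"
  shows "ncdet t (c(j := \<lambda>i. \<Sum>x\<in>S. f x i)) = (\<Sum>x\<in>S. ncdet t (c(j := f x)))"
  unfolding ncdet_row[OF assms] sum_distrib_left sum_distrib_right by (rule sum.swap)

lemma ncdet_prefix:
  assumes "\<And>p. prod_list (map (\<lambda>j. c j (p j)) [0..<t]) = y * prod_list (map (\<lambda>j. c' j (p j)) [0..<t])"
  shows "ncdet t c = y * ncdet t c'"
  unfolding ncdet_def sum_distrib_left
  by (rule sum.cong[OF refl]) (simp only: assms mult.assoc[symmetric] mult_of_int_commute[of _ y])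

text \<open>Pairing each permutation with its composite with the transposition of \<open>j\<close>
  and \<open>Suc j\<close> shows that two adjacent rows enter only through their antisymmetrized
  products. This replaces the row operations of commutative determinants.\<close>

lemma ncdet_adjacent:
  fixes c c' :: "nat \<Rightarrow> nat \<Rightarrow> 'r::ring_1"
  assumes j: "Suc j < t" and other: "\<And>k. k \<noteq> j \<Longrightarrow> k \<noteq> Suc j \<Longrightarrow> c k = c' k"
    and antisym: "\<And>p q. c j p * c (Suc j) q - c j q * c (Suc j) p = c' j p * c' (Suc j) q - c' j q * c' (Suc j) p"
  shows "ncdet t c = ncdet t c'"
proof -
  let ?\<tau> = "Transposition.transpose j (Suc j)"
  define A where "A = {\<pi>. \<pi> permutes {0..<t} \<and> \<pi> j < \<pi> (Suc j)}"
  define F where "F c \<pi> = of_int (sign \<pi>) * prod_list (map (\<lambda>k. c k (\<pi> k)) [0..<t])"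
    for c :: "nat \<Rightarrow> nat \<Rightarrow> 'r" and \<pi> :: "nat \<Rightarrow> nat"
  define L where "L c \<pi> = prod_list (map (\<lambda>k. c k (\<pi> k)) [0..<j])" for c :: "nat \<Rightarrow> nat \<Rightarrow> 'r" and \<pi> :: "nat \<Rightarrow> nat"
  define R where "R c \<pi> = prod_list (map (\<lambda>k. c k (\<pi> k)) [Suc (Suc j)..<t])"
    for c :: "nat \<Rightarrow> nat \<Rightarrow> 'r" and \<pi> :: "nat \<Rightarrow> nat"
  have F: "F c \<pi> = of_int (sign \<pi>) * (L c \<pi> * (c j (\<pi> j) * c (Suc j) (\<pi> (Suc j))) * R c \<pi>)" for c \<pi>
  proof -
    have "[Suc j..<t] = Suc j # [Suc (Suc j)..<t]" using j by (simp add: upt_conv_Cons)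
    then show ?thesis
      using j unfolding F_def L_def R_def by (subst prod_list_upt_split[of j]) (simp_all add: mult.assoc)
  qed
  have \<tau>: "?\<tau> permutes {0..<t}" using j by (intro permutes_swap_id) auto
  have LR: "L c (\<pi> \<circ> ?\<tau>) = L c \<pi>" "R c (\<pi> \<circ> ?\<tau>) = R c \<pi>" for c \<pi>
    unfolding L_def R_def by (intro arg_cong[where f = prod_list] map_cong refl; simp)+
  have sgn: "sign (\<pi> \<circ> ?\<tau>) = - sign \<pi>" if "\<pi> permutes {0..<t}" for \<pi>
    using that \<tau> by (subst sign_compose) (auto simp: sign_swap_id permutation_permutes intro: exI[of _ "{0..<t}"])
  have pair: "F c \<pi> + F c (\<pi> \<circ> ?\<tau>) = of_int (sign \<pi>) *
      (L c \<pi> * (c j (\<pi> j) * c (Suc j) (\<pi> (Suc j)) - c j (\<pi> (Suc j)) * c (Suc j) (\<pi> j)) * R c \<pi>)"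
    if "\<pi> \<in> A" for \<pi> c
    using that by (simp add: F LR A_def sgn algebra_simps)
  have eq: "F c \<pi> + F c (\<pi> \<circ> ?\<tau>) = F c' \<pi> + F c' (\<pi> \<circ> ?\<tau>)" if "\<pi> \<in> A" for \<pi>
  proof -
    have "L c \<pi> = L c' \<pi>" "R c \<pi> = R c' \<pi>"
      unfolding L_def R_def by (intro arg_cong[where f = prod_list] map_cong refl; simp add: other)+
    then show ?thesis using that by (simp add: pair antisym)
  qed
  have split: "ncdet t c = (\<Sum>\<pi>\<in>A. F c \<pi> + F c (\<pi> \<circ> ?\<tau>))" for c
  proof -
    have un: "{\<pi>. \<pi> permutes {0..<t}} = A \<union> (\<lambda>\<pi>. \<pi> \<circ> ?\<tau>) ` A"
    proof (intro Set.set_eqI iffI)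
      fix \<pi> assume "\<pi> \<in> {\<pi>. \<pi> permutes {0..<t}}"
      then have p: "\<pi> permutes {0..<t}" by simp
      then have "\<pi> j \<noteq> \<pi> (Suc j)" by (metis n_not_Suc_n permutes_inj injD)
      moreover have "\<pi> = (\<pi> \<circ> ?\<tau>) \<circ> ?\<tau>" by (simp add: comp_assoc)
      moreover have "\<pi> \<circ> ?\<tau> permutes {0..<t}" using p \<tau> by (rule permutes_compose[rotated])
      ultimately show "\<pi> \<in> A \<union> (\<lambda>\<pi>. \<pi> \<circ> ?\<tau>) ` A"
        using p by (cases "\<pi> j < \<pi> (Suc j)") (auto simp: A_def image_iff intro!: exI[of _ "\<pi> \<circ> ?\<tau>"])
    next
      fix \<pi> assume "\<pi> \<in> A \<union> (\<lambda>\<pi>. \<pi> \<circ> ?\<tau>) ` A"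
      then show "\<pi> \<in> {\<pi>. \<pi> permutes {0..<t}}"
        using \<tau> by (auto simp: A_def intro: permutes_compose)
    qed
    have fin: "finite A" unfolding A_def by (rule finite_subset[OF _ finite_permutations[of "{0..<t}"]]) auto
    have disj: "A \<inter> (\<lambda>\<pi>. \<pi> \<circ> ?\<tau>) ` A = {}" by (auto simp: A_def)
    have inj: "inj_on (\<lambda>\<pi>. \<pi> \<circ> ?\<tau>) A"
    proof (rule inj_onI)
      fix x y assume "x \<circ> ?\<tau> = y \<circ> ?\<tau>"
      then have "(x \<circ> ?\<tau>) \<circ> ?\<tau> = (y \<circ> ?\<tau>) \<circ> ?\<tau>" by simp
      then show "x = y" by (simp add: comp_assoc)
    qed
    have "ncdet t c = (\<Sum>\<pi>\<in>A \<union> (\<lambda>\<pi>. \<pi> \<circ> ?\<tau>) ` A. F c \<pi>)"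
      unfolding ncdet_def un F_def ..
    also have "\<dots> = (\<Sum>\<pi>\<in>A. F c \<pi>) + (\<Sum>\<pi>\<in>A. F c (\<pi> \<circ> ?\<tau>))"
      using fin disj inj by (simp add: sum.union_disjoint sum.reindex)
    finally show ?thesis by (simp add: sum.distrib)
  qed
  show ?thesis unfolding split by (rule sum.cong[OF refl eq])
qed

text \<open>The antisymmetrized product of the two rows is zero, so one of them may be replaced by a
  zero row.\<close>

lemma ncdet_equal_rows:
  fixes c :: "nat \<Rightarrow> nat \<Rightarrow> 'r::ring_1"
  assumes "Suc j < t" and "\<And>p q. c j p * c (Suc j) q = c j q * c (Suc j) p"
  shows "ncdet t c = 0"
proof -
  have "ncdet t c = ncdet t (c(j := \<lambda>_. 0))"
    by (rule ncdet_adjacent[OF assms(1)]) (auto simp: assms(2))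
  also have "\<dots> = 0"
    using assms(1) by (subst ncdet_row) simp_all
  finally show ?thesis .
qed

text \<open>Only permutations that fix every \<open>k < m\<close> can contribute, so the entries
  right of the diagonal in the first \<open>m\<close> rows do not matter. This allows a change of
  bounds in exhausted columns and evaluates the final determinant.\<close>

lemma ncdet_triangular:
  assumes m: "m \<le> t"
    and low: "\<And>k i. m \<le> k \<Longrightarrow> k < t \<Longrightarrow> i < m \<Longrightarrow> c k i = 0"
    and tri: "\<And>k i. k < m \<Longrightarrow> i < k \<Longrightarrow> c k i = 0"
    and tri': "\<And>k i. k < m \<Longrightarrow> i < k \<Longrightarrow> c' k i = 0"
    and diag: "\<And>k. k < m \<Longrightarrow> c k k = c' k k"
    and same: "\<And>k i. m \<le> k \<Longrightarrow> k < t \<Longrightarrow> c k i = c' k i"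
  shows "ncdet t c = ncdet t c'"
  unfolding ncdet_def
proof (rule sum.cong[OF refl])
  fix \<pi> assume "\<pi> \<in> {\<pi>. \<pi> permutes {0..<t}}"
  then have p: "\<pi> permutes {0..<t}" by simp
  have zero: "prod_list (map f [0..<t]) = 0" if "k < t" "f k = 0" for f :: "nat \<Rightarrow> 'a" and k
    using that by (simp add: prod_list_upt_split[OF that(1)])
  show "of_int (sign \<pi>) * prod_list (map (\<lambda>j. c j (\<pi> j)) [0..<t]) =
      of_int (sign \<pi>) * prod_list (map (\<lambda>j. c' j (\<pi> j)) [0..<t])"
  proof (cases "\<exists>k<t. c k (\<pi> k) = 0 \<and> c' k (\<pi> k) = 0")
    case True
    then obtain k where "k < t" "c k (\<pi> k) = 0" "c' k (\<pi> k) = 0" by blast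
    then show ?thesis using zero[of k "\<lambda>k. c k (\<pi> k)"] zero[of k "\<lambda>k. c' k (\<pi> k)"] by simp
  next
    case False
    have up: "k \<le> \<pi> k" if "k < m" for k
    proof (rule ccontr)
      assume "\<not> k \<le> \<pi> k"
      then have "c k (\<pi> k) = 0 \<and> c' k (\<pi> k) = 0" using tri tri' that by simp
      moreover have "k < t" using that m by simp
      ultimately show False using False by blast
    qed
    have stay: "m \<le> \<pi> k" if "m \<le> k" "k < t" for k
    proof (rule ccontr)
      assume "\<not> m \<le> \<pi> k"
      then have "c k (\<pi> k) = 0" by (intro low[OF that]) simp
      moreover from this have "c' k (\<pi> k) = 0" by (simp only: same[OF that, symmetric])
      ultimately show False using False \<open>k < t\<close> by blast
    qed
    have fix_low: "\<pi> k = k" if "k < m" for k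
    proof -
      \<comment> \<open>The later rows take up all later columns, which leaves
        \<open>\<pi> k\<close> no value above \<open>k\<close>.\<close>
      have "\<pi> ` {Suc k..<t} \<subseteq> {Suc k..<t}"
      proof
        fix y assume "y \<in> \<pi> ` {Suc k..<t}"
        then obtain x where x: "y = \<pi> x" "Suc k \<le> x" "x < t" by auto
        then have "\<pi> x < t" using permutes_in_image[OF p, of x] by simp
        moreover have "Suc k \<le> \<pi> x"
          using up[of x] stay[of x] x that by (cases "x < m") auto
        ultimately show "y \<in> {Suc k..<t}" using x by simp
      qed
      then have "\<pi> ` {Suc k..<t} = {Suc k..<t}"
        by (intro endo_inj_surj) (auto intro: inj_on_subset[OF permutes_inj[OF p]])
      moreover have "\<pi> k \<notin> \<pi> ` {Suc k..<t}"
        by (simp add: inj_image_mem_iff[OF permutes_inj[OF p]])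
      ultimately have "\<pi> k \<notin> {Suc k..<t}" by (rule back_subst[of "\<lambda>S. \<pi> k \<notin> S", rotated])
      moreover have "\<pi> k < t" using permutes_in_image[OF p, of k] that m by simp
      ultimately show ?thesis using up[OF that] by simp
    qed
    have "c k (\<pi> k) = c' k (\<pi> k)" if "k < t" for k
      using fix_low[of k] diag[of k] same[of k] that by (cases "k < m") auto
    then have "map (\<lambda>j. c j (\<pi> j)) [0..<t] = map (\<lambda>j. c' j (\<pi> j)) [0..<t]"
      by (intro map_cong) auto
    then show ?thesis by (simp only:)
  qed
qed

lemma prod_list_commute:
  fixes y :: "'r::monoid_mult"
  assumes "\<And>x. x \<in> set xs \<Longrightarrow> y * x = x * y"
  shows "y * prod_list xs = prod_list xs * y"
  using assms by (induction xs) (simp_all, metis mult.assoc)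

text \<open>Each \<open>x k'\<close> has to cross every \<open>E k\<close> with
  \<open>k < k'\<close>. A crossing that relies on \<open>x k\<close> in front is possible only for
  \<open>k' = Suc k\<close>: the factors to the right have already been separated, so
  \<open>x k * E k\<close> then meets \<open>x (Suc k)\<close> directly.\<close>

lemma prod_list_separate:
  fixes x E :: "nat \<Rightarrow> 'r::monoid_mult"
  assumes "\<And>k k'. k < k' \<Longrightarrow> k' < t \<Longrightarrow>
    k' = Suc k \<and> x k * E k * x k' = x k * x k' * E k \<or> E k * x k' = x k' * E k"
  shows "prod_list (map (\<lambda>k. x k * E k) [0..<t]) = prod_list (map x [0..<t]) * prod_list (map E [0..<t])"
proof -
  have "prod_list (map (\<lambda>k. x k * E k) [j..<t]) = prod_list (map x [j..<t]) * prod_list (map E [j..<t])"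
    if "j \<le> t" for j
    using that
  proof (induction j rule: inc_induct)
    case (step j)
    let ?X = "prod_list (map x [Suc j..<t])"
    have "x j * E j * ?X = x j * ?X * E j"
    proof (cases "Suc j < t")
      case True
      let ?Y = "prod_list (map x [Suc (Suc j)..<t])"
      have Y: "E j * ?Y = ?Y * E j"
      proof (rule prod_list_commute)
        fix y assume "y \<in> set (map x [Suc (Suc j)..<t])"
        then obtain k' where "y = x k'" "Suc (Suc j) \<le> k'" "k' < t" by auto
        then show "E j * y = y * E j" using assms[of j k'] by auto
      qed
      have X: "?X = x (Suc j) * ?Y" using True by (simp add: upt_conv_Cons)
      have "x j * E j * x (Suc j) = x j * x (Suc j) * E j"
        using assms[of j "Suc j"] True by (auto simp: mult.assoc)
      then have "x j * E j * (x (Suc j) * ?Y) = x j * x (Suc j) * (E j * ?Y)"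
        by (simp only: mult.assoc[symmetric])
      then show ?thesis unfolding X Y by (simp only: mult.assoc)
    qed simp
    then have "x j * E j * (?X * prod_list (map E [Suc j..<t])) =
        x j * ?X * (E j * prod_list (map E [Suc j..<t]))" by (simp only: mult.assoc[symmetric])
    then show ?case using step by (simp add: upt_conv_Cons mult.assoc)
  qed simp
  from this[of 0] show ?thesis by simp
qed

section \<open>Peeling off one diagonal\<close>

lemma sum_PiE_insert:
  assumes "a \<notin> S"
  shows "(\<Sum>z\<in>Pi\<^sub>E (insert a S) T. g z) = (\<Sum>z\<in>Pi\<^sub>E S T. \<Sum>x\<in>T a. g (z(a := x)))"
proof -
  have "(\<Sum>z\<in>Pi\<^sub>E (insert a S) T. g z) = (\<Sum>(x, z)\<in>T a \<times> Pi\<^sub>E S T. g (z(a := x)))"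
    unfolding PiE_insert_eq
    by (subst sum.reindex[OF inj_combinator[OF assms]]) (simp add: case_prod_unfold)
  also have "\<dots> = (\<Sum>z\<in>Pi\<^sub>E S T. \<Sum>x\<in>T a. g (z(a := x)))"
    unfolding sum.cartesian_product[symmetric] by (rule sum.swap)
  finally show ?thesis .
qed

lemma prod_list_ones: "prod_list (map (\<lambda>_. 1) xs) = (1 :: 'a::monoid_mult)"
  by (induction xs) auto

text \<open>The left neighbour of a new box in column \<open>m\<close> lies on the previous diagonal
  in column \<open>m - 1\<close>, and \<open>f (m - 1)\<close> is its flag. Column 0 has no left
  neighbour; the bound 0 only demands a positive index.\<close>

definition lower :: "(nat \<Rightarrow> nat) \<Rightarrow> nat \<Rightarrow> nat" where
  "lower f m = (case m of 0 \<Rightarrow> 0 | Suc k \<Rightarrow> f k)"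

definition choices :: "(nat \<Rightarrow> nat) \<Rightarrow> nat \<Rightarrow> letter set" where
  "choices f m = {x. lower f m < idx x \<and> idx x \<le> f m}"

context kron_letters
begin

definition unb_part :: "letter \<Rightarrow> 'r" where "unb_part x = (if \<not> is_barred x then u x else 1)"
definition bar_part :: "letter \<Rightarrow> 'r" where "bar_part x = (if is_barred x then u x else 1)"

lemma ncdet_pull_far:
  assumes m: "m < t" and comm: "\<And>k i. k < m \<Longrightarrow> C k i * y = y * C k i"
  shows "ncdet t (C(m := \<lambda>i. y * r i)) = y * ncdet t (C(m := r))"
proof (rule ncdet_prefix)
  fix p
  have 1: "map (\<lambda>j. (C(m := f)) j (p j)) [0..<m] = map (\<lambda>j. C j (p j)) [0..<m]"
    and 2: "map (\<lambda>j. (C(m := f)) j (p j)) [Suc m..<t] = map (\<lambda>j. C j (p j)) [Suc m..<t]" for f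
    by auto
  have "y * prod_list (map (\<lambda>j. C j (p j)) [0..<m]) = prod_list (map (\<lambda>j. C j (p j)) [0..<m]) * y"
    by (rule prod_list_commute) (auto simp: comm)
  then show "prod_list (map (\<lambda>j. (C(m := \<lambda>i. y * r i)) j (p j)) [0..<t]) =
      y * prod_list (map (\<lambda>j. (C(m := r)) j (p j)) [0..<t])"
    unfolding prod_list_upt_split[OF m] 1 2 by (simp add: mult.assoc[symmetric])
qed

text \<open>By \<open>esf_Unb_antisym\<close> the letter may be moved from row \<open>Suc m\<close>
  to row \<open>m\<close>, although it does not commute with that row. The shifts differ by one
  because row \<open>Suc m\<close> has lost its leading letter.\<close>

lemma ncdet_pull_near:
  assumes m: "Suc m < t"
    and row: "C m = (\<lambda>i. e a (b + int i))"
    and comm: "\<And>k i. k < m \<Longrightarrow> C k i * U (Suc a) = U (Suc a) * C k i"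
  shows "ncdet t (C(Suc m := \<lambda>i. U (Suc a) * e a (b - 1 + int i))) =
    U (Suc a) * ncdet t (C(Suc m := \<lambda>i. e a (b - 1 + int i)))"
proof -
  let ?r = "\<lambda>i. e a (b - 1 + int i)"
  let ?C = "C(Suc m := ?r)"
  have "ncdet t (C(Suc m := \<lambda>i. U (Suc a) * ?r i)) = ncdet t (?C(m := \<lambda>i. U (Suc a) * e a (b + int i)))"
    using esf_Unb_antisym[of a "b + int _" "b + int _"]
    by (intro ncdet_adjacent[OF m]) (simp_all add: row mult.assoc algebra_simps)
  also have "\<dots> = U (Suc a) * ncdet t (?C(m := \<lambda>i. e a (b + int i)))"
    by (rule ncdet_pull_far) (use m comm in auto)
  also have "?C(m := \<lambda>i. e a (b + int i)) = ?C" by (auto simp: row)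
  finally show ?thesis .
qed

end

text \<open>The columns \<open>j0, \<dots>, j1 - 1\<close> are those that meet the next diagonal; the columns before \<open>j0\<close> are
  exhausted. Row \<open>k\<close> of the determinant is \<open>e (f k) (\<beta> k + i)\<close>.\<close>

locale peeling = kron_letters u for u :: "letter \<Rightarrow> 'r::ring_1" +
  fixes t j0 j1 :: nat and \<beta> :: "nat \<Rightarrow> int" and \<delta> :: int and f :: "nat \<Rightarrow> nat"
  assumes j0_le: "j0 \<le> j1" and j1_le: "j1 \<le> t"
    and beta_mid: "\<And>k. j0 \<le> Suc k \<Longrightarrow> k < j1 \<Longrightarrow> \<beta> k = \<delta>"
    and delta_pos: "j0 = 0 \<Longrightarrow> 1 \<le> \<delta>"
    and beta_low: "\<And>k. k < j0 \<Longrightarrow> \<beta> k = - int k"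
    and beta_high: "\<And>k. j1 \<le> k \<Longrightarrow> k < t \<Longrightarrow> 0 < j0 \<Longrightarrow> \<beta> k \<le> - int j0"
    and f_mono: "\<And>k. j0 \<le> Suc k \<Longrightarrow> Suc k < j1 \<Longrightarrow> f k \<le> f (Suc k)"
    and f_low: "\<And>k. Suc k < j0 \<Longrightarrow> f k = 0"
begin

definition plain :: "nat \<Rightarrow> nat \<Rightarrow> 'r" where "plain k i = e (f k) (\<beta> k + int i)"

text \<open>The state after expanding the columns \<open>m, ..., j1 - 1\<close>: their unbarred
  letters have left the determinant, and their barred letters still head their rows.\<close>

definition mixed :: "nat \<Rightarrow> (nat \<Rightarrow> letter) \<Rightarrow> nat \<Rightarrow> nat \<Rightarrow> 'r" where
  "mixed m z k = (if m \<le> k \<and> k < j1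
     then \<lambda>i. bar_part (z k) * e (flag (z k)) (\<beta> k - 1 + int i) else plain k)"

definition new_flag :: "(nat \<Rightarrow> letter) \<Rightarrow> nat \<Rightarrow> nat" where
  "new_flag z k = (if k < j0 then 0 else if k < j1 then flag (z k) else f k)"

definition new_beta :: "nat \<Rightarrow> int" where
  "new_beta k = (if j0 \<le> k \<and> k < j1 then \<beta> k - 1 else \<beta> k)"

text \<open>For \<open>m > 0\<close> the rows \<open>m - 1\<close> and \<open>m\<close> coincide.
  For \<open>m = 0\<close> every entry of row 0 is a coefficient of positive degree of
  \<open>e 0\<close>, hence zero.\<close>

lemma lower_row_zero:
  assumes "j0 \<le> m" "m < j1" and C: "\<And>k. k < m \<Longrightarrow> C k = plain k"
  shows "ncdet t (C(m := \<lambda>i. e (lower f m) (\<beta> m + int i))) = 0"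
proof (cases m)
  case 0
  then have "1 \<le> \<beta> m" using assms delta_pos beta_mid[of 0] by simp
  then have "e (lower f m) (\<beta> m + int i) = 0" for i using 0 by (simp add: lower_def esf_0)
  moreover have "m < t" using assms j1_le by simp
  ultimately show ?thesis by (simp add: ncdet_row)
next
  case (Suc k)
  then have "\<beta> k = \<delta>" "\<beta> m = \<delta>" using assms beta_mid by auto
  then show ?thesis using Suc assms j1_le
    by (intro ncdet_equal_rows[of k]) (auto simp: lower_def C plain_def esf_commute)
qed

end

text \<open>Two equal neighbouring bounds make both sides of \<open>peel\<close> zero. Otherwise the
  bounds increase strictly, which keeps all rows but the preceding one far from a new
  letter.\<close>

locale peeling_strict = peeling +
  assumes f_strict: "\<And>k. j0 \<le> Suc k \<Longrightarrow> Suc k < j1 \<Longrightarrow> f k < f (Suc k)"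
begin

lemma f_less: "j0 \<le> Suc k \<Longrightarrow> k < m \<Longrightarrow> m < j1 \<Longrightarrow> f k < f m"
proof (induction m)
  case (Suc m)
  then show ?case using f_strict[of m] by (cases "k = m") (auto intro: less_trans)
qed simp

text \<open>A row \<open>k\<close> with \<open>Suc k < m\<close> has bound 0 or satisfies
  \<open>f k < f (m - 1) < a\<close>, so it commutes with \<open>U a\<close>. Only the preceding row
  with \<open>a = Suc (f (m - 1))\<close> can obstruct, and there the antisymmetrization
  helps.\<close>

lemma pull_unb:
  assumes m: "j0 \<le> m" "m < j1" and C: "\<And>k. k < m \<Longrightarrow> C k = plain k"
    and a: "lower f m < a"
  shows "ncdet t (C(m := \<lambda>i. U a * e (a - 1) (\<beta> m - 1 + int i))) =
    U a * ncdet t (C(m := \<lambda>i. e (a - 1) (\<beta> m - 1 + int i)))"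
proof -
  have mt: "m < t" using m j1_le by simp
  have far: "C k i * U a = U a * C k i" if "f k + 2 \<le> a \<or> f k = 0" "k < m" for k i
    using that esf_far[of "f k" "Unb a" "\<beta> k + int i"] by (auto simp: C plain_def esf_0)
  have far2: "f k + 2 \<le> a \<or> f k = 0" if "Suc k < m" for k
  proof (cases "Suc k < j0")
    case True then show ?thesis by (simp add: f_low)
  next
    case False
    then have "f k < f (m - 1)" using that m by (intro f_less) auto
    moreover have "f (m - 1) < a" using a that by (cases m) (auto simp: lower_def)
    ultimately show ?thesis by simp
  qed
  show ?thesis
  proof (cases "\<exists>k. m = Suc k \<and> a = Suc (f k)")
    case True
    then obtain k where k: "m = Suc k" "a = Suc (f k)" by blast
    then have "\<beta> k = \<delta>" "\<beta> m = \<delta>" using m beta_mid by auto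
    then show ?thesis
      using ncdet_pull_near[of k t C "f k" "\<beta> m"] k mt far far2 C by (simp add: plain_def fun_eq_iff)
  next
    case False
    have "f k + 2 \<le> a \<or> f k = 0" if "k < m" for k
    proof (cases "m = Suc k")
      case True
      then show ?thesis using False a by (auto simp: lower_def)
    next
      case False
      then show ?thesis using far2[of k] that by simp
    qed
    then show ?thesis by (intro ncdet_pull_far[OF mt] far)
  qed
qed

lemma extract_row:
  assumes m: "j0 \<le> m" "m < j1"
  shows "ncdet t (mixed (Suc m) z) = (\<Sum>x\<in>choices f m. unb_part x * ncdet t (mixed m (z(m := x))))"
proof -
  let ?C = "mixed (Suc m) z"
  let ?r = "\<lambda>x i. e (flag x) (\<beta> m - 1 + int i)"
  have mt: "m < t" using m j1_le by simp
  have C: "?C k = plain k" if "k < Suc m" for k using that by (simp add: mixed_def)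
  \<comment> \<open>Splitting the expansion at \<open>lower f m\<close> isolates the letters too
    small for the left neighbour; together they form the vanishing determinant of
    \<open>lower_row_zero\<close>.\<close>
  have le: "lower f m \<le> f m"
    using m f_mono[of "m - 1"] by (cases m) (auto simp: lower_def)
  have "?C m = (\<lambda>i. e (lower f m) (\<beta> m + int i) + (\<Sum>x\<in>choices f m. u x * ?r x i))"
    using esf_expand[OF le] by (simp add: C plain_def choices_def fun_eq_iff algebra_simps)
  then have "?C = ?C(m := \<lambda>i. e (lower f m) (\<beta> m + int i) + (\<Sum>x\<in>choices f m. u x * ?r x i))"
    by (metis fun_upd_triv)
  then have "ncdet t ?C = ncdet t (?C(m := \<lambda>i. e (lower f m) (\<beta> m + int i) + (\<Sum>x\<in>choices f m. u x * ?r x i)))"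
    by (rule arg_cong)
  also have "\<dots> = (\<Sum>x\<in>choices f m. ncdet t (?C(m := \<lambda>i. u x * ?r x i)))"
    using lower_row_zero[OF m, of ?C] C by (simp add: ncdet_row_add[OF mt] ncdet_row_sum[OF mt])
  also have "\<dots> = (\<Sum>x\<in>choices f m. unb_part x * ncdet t (mixed m (z(m := x))))"
  proof (rule sum.cong[OF refl])
    fix x assume x: "x \<in> choices f m"
    have mix: "mixed m (z(m := x)) = ?C(m := \<lambda>i. bar_part x * ?r x i)"
      using m by (auto simp: mixed_def fun_eq_iff)
    show "ncdet t (?C(m := \<lambda>i. u x * ?r x i)) = unb_part x * ncdet t (mixed m (z(m := x)))"
    proof (cases x)
      case (Unb a)
      then show ?thesis unfolding mix using pull_unb[OF m, of ?C a] C x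
        by (simp add: unb_part_def bar_part_def choices_def)
    next
      case (Bar a)
      then show ?thesis unfolding mix by (simp add: unb_part_def bar_part_def)
    qed
  qed
  finally show ?thesis .
qed

lemma extract_rows:
  assumes "j0 \<le> m" "m \<le> j1"
  shows "ncdet t plain = (\<Sum>z\<in>Pi\<^sub>E {m..<j1} (choices f).
    prod_list (map (\<lambda>j. unb_part (z j)) (rev [m..<j1])) * ncdet t (mixed m z))"
  using assms(2,1)
proof (induction m rule: inc_induct)
  case base
  have "mixed j1 z = plain" for z by (rule ext) (auto simp: mixed_def)
  then show ?case by simp
next
  case (step m)
  have set: "{m..<j1} = insert m {Suc m..<j1}" using step.hyps by auto
  have rev: "rev [m..<j1] = rev [Suc m..<j1] @ [m]" using step.hyps by (simp add: upt_conv_Cons)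
  have "prod_list (map (\<lambda>j. unb_part ((z(m := x)) j)) (rev [m..<j1])) =
      prod_list (map (\<lambda>j. unb_part (z j)) (rev [Suc m..<j1])) * unb_part x" for z x
  proof -
    have "map (\<lambda>j. unb_part ((z(m := x)) j)) (rev [Suc m..<j1]) = map (\<lambda>j. unb_part (z j)) (rev [Suc m..<j1])"
      by auto
    then show ?thesis by (simp only: rev map_append prod_list.append) simp
  qed
  then show ?case
    using step by (simp add: set sum_PiE_insert extract_row sum_distrib_left mult.assoc del: map_map)
qed

text \<open>Triangularity first permits the bound 0 in the rows before \<open>j0\<close>, which
  makes their entries central. Then every barred letter can cross the rows above it in each product
  separately.\<close>

lemma pull_bars:
  assumes z: "z \<in> Pi\<^sub>E {j0..<j1} (choices f)"
  shows "ncdet t (mixed j0 z) = prod_list (map (\<lambda>j. bar_part (z j)) [j0..<j1]) *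
    ncdet t (\<lambda>k i. e (new_flag z k) (new_beta k + int i))"
proof -
  let ?x = "\<lambda>k. if j0 \<le> k \<and> k < j1 then bar_part (z k) else 1"
  let ?E = "\<lambda>k i. e (new_flag z k) (new_beta k + int i)"
  have zc: "lower f k < idx (z k)" "idx (z k) \<le> f k" if "j0 \<le> k" "k < j1" for k
    using PiE_mem[OF z, of k] that by (auto simp: choices_def)
  have "ncdet t (mixed j0 z) = ncdet t (\<lambda>k i. ?x k * ?E k i)"
  proof (rule ncdet_triangular[of j0])
    \<comment> \<open>This makes the entries of the rows from \<open>j0\<close> on vanish in the
      columns before \<open>j0\<close>. The value of \<open>\<delta>\<close> comes from column
      \<open>j0 - 1\<close>, where \<open>beta_mid\<close> and \<open>beta_low\<close>
      overlap.\<close>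
    have beta: "new_beta k \<le> - int j0" if "j0 \<le> k" "k < t" "0 < j0" for k
    proof (cases "k < j1")
      case True
      have "\<beta> k = \<delta>" "\<beta> (j0 - 1) = \<delta>" by (rule beta_mid; use True that in simp)+
      moreover have "\<beta> (j0 - 1) = 1 - int j0" using that by (subst beta_low) auto
      ultimately show ?thesis using True that by (simp add: new_beta_def)
    next
      case False
      then show ?thesis using beta_high[of k] that by (simp add: new_beta_def)
    qed
    fix k i :: nat
    show same: "mixed j0 z k i = ?x k * ?E k i" if "j0 \<le> k" "k < t"
      using that by (auto simp: mixed_def plain_def new_flag_def new_beta_def)
    show "mixed j0 z k i = 0" if "j0 \<le> k" "k < t" "i < j0"
    proof -
      have "?E k i = 0" using beta[OF that(1,2)] that by (intro esf_neg) simp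
      then show ?thesis using same[OF that(1,2)] by simp
    qed
    show "mixed j0 z k i = 0" "?x k * ?E k i = 0" if "k < j0" "i < k"
      using that by (simp_all add: mixed_def plain_def new_beta_def beta_low esf_neg)
    show "mixed j0 z k k = ?x k * ?E k k" if "k < j0"
      using that by (simp add: mixed_def plain_def new_beta_def beta_low esf_zero)
  qed (use j0_le j1_le in simp)
  also have "\<dots> = prod_list (map ?x [0..<t]) * ncdet t ?E"
  proof (rule ncdet_prefix, rule prod_list_separate)
    fix p :: "nat \<Rightarrow> nat" and k k' :: nat
    assume k: "k < k'" "k' < t"
    show "k' = Suc k \<and> ?x k * ?E k (p k) * ?x k' = ?x k * ?x k' * ?E k (p k) \<or>
        ?E k (p k) * ?x k' = ?x k' * ?E k (p k)"
    proof (cases "j0 \<le> k \<and> k' < j1 \<and> is_barred (z k')")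
      case True
      then obtain a where a: "z k' = Bar a" by (cases "z k'") auto
      have "f (k' - 1) < a" using zc(1)[of k'] a True k by (cases k') (auto simp: lower_def)
      moreover have "f k \<le> f (k' - 1)"
        using True k by (cases "k' = Suc k") (simp, intro less_imp_le f_less, auto)
      moreover have fl: "flag (z k) \<le> idx (z k)" by (cases "z k") auto
      ultimately have le: "flag (z k) \<le> f k" "f k < a" using zc[of k] True k by auto
      show ?thesis
      proof (cases "flag (z k) + 2 \<le> a")
        case far: True
        then show ?thesis
          using a True k esf_far[of "flag (z k)" "Bar a"] by (simp add: new_flag_def bar_part_def)
      next
        case near: False
        \<comment> \<open>The letters \<open>z k'\<close> and the rest of row \<open>k\<close> can
          interact only if all bounds are tight. Then \<open>z k\<close> is barred, since
          \<open>Unb (f k)\<close> would leave a flag two below \<open>a\<close>.\<close>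
        then have "flag (z k) = idx (z k)" "flag (z k) = f k" "a = Suc (f k)"
          using le zc[of k] True k fl by auto
        then have zk: "z k = Bar (f k)" using zc[of k] True k by (cases "z k") auto
        have "k' = Suc k"
        proof (rule ccontr)
          assume "k' \<noteq> Suc k"
          then have "f k < f (k' - 1)" using True k by (intro f_less) auto
          then show False using \<open>f (k' - 1) < a\<close> \<open>a = Suc (f k)\<close> by simp
        qed
        moreover have "?x k * ?E k (p k) * ?x k' = ?x k * ?x k' * ?E k (p k)"
          using Bar_esf_Bar[of "f k"] True k a zk \<open>a = Suc (f k)\<close> by (simp add: bar_part_def new_flag_def)
        ultimately show ?thesis by blast
      qed
    next
      case False
      then consider "k < j0" | "j1 \<le> k'" | "\<not> is_barred (z k')" by linarith
      then show ?thesis by cases (use k in \<open>auto simp: new_flag_def bar_part_def esf_0\<close>)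
    qed
  qed
  also have "prod_list (map ?x [0..<t]) = prod_list (map (\<lambda>j. bar_part (z j)) [j0..<j1])"
  proof -
    have "[0..<t] = [0..<j0] @ [j0..<j1] @ [j1..<t]"
      using j0_le j1_le by (metis le_add_diff_inverse le_trans upt_add_eq_append zero_le)
    moreover have "map ?x [0..<j0] = map (\<lambda>_. 1) [0..<j0]" "map ?x [j1..<t] = map (\<lambda>_. 1) [j1..<t]"
      "map ?x [j0..<j1] = map (\<lambda>j. bar_part (z j)) [j0..<j1]"
      by auto
    ultimately show ?thesis by (simp only: map_append prod_list.append prod_list_ones) simp
  qed
  finally show ?thesis .
qed

end

context peeling
begin

lemma peel:
  "ncdet t plain = (\<Sum>z\<in>Pi\<^sub>E {j0..<j1} (choices f).
     prod_list (map (\<lambda>j. unb_part (z j)) (rev [j0..<j1])) * prod_list (map (\<lambda>j. bar_part (z j)) [j0..<j1]) *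
     ncdet t (\<lambda>k i. e (new_flag z k) (new_beta k + int i)))"
proof (cases "\<forall>k. j0 \<le> Suc k \<longrightarrow> Suc k < j1 \<longrightarrow> f k < f (Suc k)")
  case True
  then interpret peeling_strict u t j0 j1 \<beta> \<delta> f by unfold_locales blast
  show ?thesis
    using extract_rows[of j0] j0_le by (simp add: pull_bars mult.assoc)
next
  case False
  then obtain k where k: "j0 \<le> Suc k" "Suc k < j1" "f k = f (Suc k)" using f_mono by (meson le_neq_implies_less)
  then have "choices f (Suc k) = {}" by (auto simp: choices_def lower_def)
  then have "Pi\<^sub>E {j0..<j1} (choices f) = {}" using k by (auto simp: PiE_eq_empty_iff)
  moreover have "ncdet t plain = 0"
    using k beta_mid[of k] beta_mid[of "Suc k"] j1_le
    by (intro ncdet_equal_rows[of k]) (auto simp: plain_def esf_commute)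
  ultimately show ?thesis by simp
qed

end

section \<open>Tableaux and diagonals\<close>

lemma alphabet_iff: "x \<in> alphabet N \<longleftrightarrow> 1 \<le> idx x \<and> idx x \<le> N"
  by (cases x) (auto simp: alphabet_def)

lemma flag_le_idx: "flag x \<le> idx x" and idx_le_flag: "idx x \<le> Suc (flag x)"
  by (cases x; simp)+

lemma row_condition:
  "1 \<le> idx x \<Longrightarrow> (x \<le> y \<and> (is_barred x \<and> is_barred y \<longrightarrow> x < y)) \<longleftrightarrow> flag x < idx y"
  by (cases x; cases y) (auto simp: less_eq_letter_def less_letter_def)

lemma column_condition:
  "1 \<le> idx y \<Longrightarrow> (x \<le> y \<and> (\<not> is_barred x \<and> \<not> is_barred y \<longrightarrow> x < y)) \<longleftrightarrow> idx x \<le> flag y"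
  by (cases x; cases y) (auto simp: less_eq_letter_def less_letter_def)

lemma down_closed_interval:
  fixes S :: "nat set"
  assumes "finite S" "S \<subseteq> {m..}" "\<And>i j. j \<in> S \<Longrightarrow> m \<le> i \<Longrightarrow> i \<le> j \<Longrightarrow> i \<in> S"
  shows "S = {m..<m + card S}"
proof (cases "S = {}")
  case False
  have "S = {m..<Suc (Max S)}"
  proof
    show "S \<subseteq> {m..<Suc (Max S)}" using assms(1,2) by (auto simp: less_Suc_eq_le)
    show "{m..<Suc (Max S)} \<subseteq> S"
      using assms(3)[OF Max_in[OF assms(1) False]] by (auto simp: less_Suc_eq_le)
  qed
  moreover from this have "card S = Suc (Max S) - m" by (metis card_atLeastLessThan)
  moreover have "m \<le> Max S" using Max_in[OF assms(1) False] assms(2) by auto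
  ultimately show ?thesis by simp
qed simp

locale shape =
  fixes N :: nat and \<nu> :: "nat list"
  assumes partition: "is_partition \<nu>"
begin

abbreviation "col \<equiv> conj_part \<nu>"
abbreviation "wid \<equiv> first_part \<nu>"

lemma in_diagram: "(r, j) \<in> diagram \<nu> \<longleftrightarrow> r < col j"
proof -
  let ?S = "{i. i < length \<nu> \<and> j < \<nu> ! i}"
  have "?S = {0..<0 + card ?S}"
  proof (rule down_closed_interval)
    fix i k assume "k \<in> ?S" "i \<le> k"
    moreover from this have "\<nu> ! k \<le> \<nu> ! i"
      using partition by (cases "i = k") (auto simp: is_partition_def sorted_wrt_iff_nth_less)
    ultimately show "i \<in> ?S" by simp
  qed auto
  then have "r \<in> ?S \<longleftrightarrow> r < col j" by (metis add_0 atLeastLessThan_iff conj_part_def zero_le)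
  then show ?thesis by (simp add: diagram_def)
qed

lemma diagram_bounds: "(r, j) \<in> diagram \<nu> \<Longrightarrow> r < length \<nu> \<and> j < wid"
proof -
  assume "(r, j) \<in> diagram \<nu>"
  then have "r < length \<nu>" "j < \<nu> ! r" by (auto simp: diagram_def)
  moreover have "\<nu> ! r \<le> \<nu> ! 0"
    using partition \<open>r < length \<nu>\<close> by (cases "r = 0") (auto simp: is_partition_def sorted_wrt_iff_nth_less)
  moreover have "wid = \<nu> ! 0" using \<open>r < length \<nu>\<close> by (cases \<nu>) (auto simp: first_part_def)
  ultimately show ?thesis by simp
qed

lemma col_antimono: "i \<le> j \<Longrightarrow> col j \<le> col i"
  unfolding conj_part_def by (rule card_mono) auto

lemma col_le_length: "col j \<le> length \<nu>"
  by (metis diagram_bounds in_diagram not_le order_less_irrefl)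

lemma finite_diagram: "finite (diagram \<nu>)"
  by (rule finite_subset[of _ "{..<length \<nu>} \<times> {..<wid}"]) (use diagram_bounds in auto)

definition content :: "nat \<times> nat \<Rightarrow> int" where "content b = int (snd b) - int (fst b)"

text \<open>One past the last column that meets the diagonal; counting columns gives an empty
  diagonal the value \<open>nat d\<close>, so its interval of columns is empty.\<close>

definition diag_end :: "int \<Rightarrow> nat" where
  "diag_end d = nat d + card {j. d \<le> int j \<and> nat (int j - d) < col j}"

lemma diag_columns: "{j. d \<le> int j \<and> nat (int j - d) < col j} = {nat d..<diag_end d}"
  unfolding diag_end_def
proof (rule down_closed_interval)
  show "finite {j. d \<le> int j \<and> nat (int j - d) < col j}"
    by (rule finite_subset[of _ "{..<wid}"]) (use diagram_bounds in_diagram in auto)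
  fix i j assume j: "j \<in> {j. d \<le> int j \<and> nat (int j - d) < col j}" and i: "nat d \<le> i" "i \<le> j"
  then have "nat (int i - d) \<le> nat (int j - d)" "nat (int j - d) < col j" by simp_all
  then have "nat (int i - d) < col i" using col_antimono[OF i(2)] by linarith
  then show "i \<in> {j. d \<le> int j \<and> nat (int j - d) < col j}" using i(1) by simp
qed auto

lemma diag_end_iff: "d \<le> int j \<Longrightarrow> j < diag_end d \<longleftrightarrow> nat (int j - d) < col j"
proof -
  assume d: "d \<le> int j"
  have "j \<in> {nat d..<diag_end d} \<longleftrightarrow> d \<le> int j \<and> nat (int j - d) < col j"
    unfolding diag_columns[symmetric] by simp
  moreover have "nat d \<le> j" using d by simp
  ultimately show ?thesis using d by (simp only: atLeastLessThan_iff) simp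
qed

lemma diag_end_le: "d \<le> int wid \<Longrightarrow> diag_end d \<le> wid"
proof -
  assume d: "d \<le> int wid"
  have "j < wid" if "j \<in> {nat d..<diag_end d}" for j
    using that diagram_bounds in_diagram unfolding diag_columns[symmetric] by blast
  then have "nat d < diag_end d \<Longrightarrow> diag_end d - 1 < wid" by auto
  then show ?thesis using d by linarith
qed

lemma nat_le_diag_end: "nat d \<le> diag_end d"
  by (simp add: diag_end_def)

text \<open>Reindexing by columns matches the rows of the determinant, which correspond to columns
  of the shape.\<close>

lemma diagonal_eq: "diagonal \<nu> d = map (\<lambda>j. (nat (int j - d), j)) [nat d..<diag_end d]"
proof -
  define rs where "rs = filter (\<lambda>r. 0 \<le> int r + d \<and> (r, nat (int r + d)) \<in> diagram \<nu>) [0..<length \<nu>]"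
  define js where "js = map (\<lambda>r. nat (int r + d)) rs"
  have rs: "r \<in> set rs \<longleftrightarrow> 0 \<le> int r + d \<and> r < col (nat (int r + d))" for r
    using diagram_bounds[of r] by (auto simp: rs_def in_diagram)
  have "sorted_wrt (<) js"
    unfolding js_def sorted_wrt_map
    by (rule sorted_wrt_mono_rel[of _ "(<)"]) (auto simp: rs, simp add: rs_def sorted_wrt_filter)
  moreover have "set js = set [nat d..<diag_end d]"
  proof -
    have "set js = {j. d \<le> int j \<and> nat (int j - d) < col j}"
    proof (intro Set.set_eqI iffI)
      fix j assume "j \<in> {j. d \<le> int j \<and> nat (int j - d) < col j}"
      then have j: "d \<le> int j" "nat (int j - d) < col j" by auto
      then have "nat (int (nat (int j - d)) + d) = j" by simp
      moreover from this have "nat (int j - d) \<in> set rs" using j by (simp only: rs) simp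
      ultimately show "j \<in> set js" unfolding js_def set_map by (intro image_eqI[of _ _ "nat (int j - d)"]) (simp_all only:)
    qed (auto simp: js_def rs)
    then show ?thesis by (simp add: diag_columns)
  qed
  ultimately have js: "js = [nat d..<diag_end d]" by (intro strict_sorted_equal) auto
  have "diagonal \<nu> d = map (\<lambda>j. (nat (int j - d), j)) js"
    unfolding diagonal_def js_def rs_def[symmetric] by (auto simp: rs)
  then show ?thesis by (simp add: js)
qed

text \<open>When the boxes of content at most \<open>d\<close> are removed, column \<open>j\<close> keeps
  \<open>min (col j) (max 0 (j - d))\<close> boxes, and \<open>colflag T d j\<close> bounds the index of their letters.
  The value \<open>0\<close> for \<open>j < d\<close> is a convention; it makes the rows of such columns central.\<close>

definition beta :: "int \<Rightarrow> nat \<Rightarrow> int" where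
  "beta d j = min (int (col j)) (max 0 (int j - d)) - int j"

definition colflag :: "(nat \<times> nat \<Rightarrow> letter) \<Rightarrow> int \<Rightarrow> nat \<Rightarrow> nat" where
  "colflag T d j = (if int j < d then 0
     else if nat (int j - d) < col j then flag (T (nat (int j - d), j)) else N)"

text \<open>Only neighbouring boxes are compared. In each pair the content bound is put on the right
  or upper box, which has the larger content.\<close>

definition tabs :: "int \<Rightarrow> (nat \<times> nat \<Rightarrow> letter) set" where
  "tabs d = {T \<in> {b \<in> diagram \<nu>. content b \<le> d} \<rightarrow>\<^sub>E alphabet N.
     (\<forall>r c. (r, Suc c) \<in> diagram \<nu> \<and> content (r, Suc c) \<le> d \<longrightarrow> flag (T (r, c)) < idx (T (r, Suc c))) \<and>
     (\<forall>r c. (Suc r, c) \<in> diagram \<nu> \<and> content (r, c) \<le> d \<longrightarrow> idx (T (r, c)) \<le> flag (T (Suc r, c)))}"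

lemma finite_tabs: "finite (tabs d)"
proof (rule finite_subset)
  show "tabs d \<subseteq> {b \<in> diagram \<nu>. content b \<le> d} \<rightarrow>\<^sub>E alphabet N" by (auto simp: tabs_def)
  show "finite ({b \<in> diagram \<nu>. content b \<le> d} \<rightarrow>\<^sub>E alphabet N)"
    by (intro finite_PiE finite_subset[OF _ finite_diagram]) (auto simp: alphabet_def)
qed

lemma tabs_alphabet:
  "T \<in> tabs d \<Longrightarrow> (r, c) \<in> diagram \<nu> \<Longrightarrow> content (r, c) \<le> d \<Longrightarrow> 1 \<le> idx (T (r, c)) \<and> idx (T (r, c)) \<le> N"
  using PiE_mem[of T "{b \<in> diagram \<nu>. content b \<le> d}" "\<lambda>_. alphabet N" "(r, c)"]
  by (auto simp: tabs_def alphabet_iff)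

lemma tabs_undefined: "T \<in> tabs d \<Longrightarrow> \<not> (b \<in> diagram \<nu> \<and> content b \<le> d) \<Longrightarrow> T b = undefined"
  using PiE_arb[of T "{b \<in> diagram \<nu>. content b \<le> d}" "\<lambda>_. alphabet N" b]
  by (simp add: tabs_def)

lemma tabs_row: "T \<in> tabs d \<Longrightarrow> (r, Suc c) \<in> diagram \<nu> \<Longrightarrow> content (r, Suc c) \<le> d \<Longrightarrow>
    flag (T (r, c)) < idx (T (r, Suc c))"
  by (simp add: tabs_def)

lemma tabs_column: "T \<in> tabs d \<Longrightarrow> (Suc r, c) \<in> diagram \<nu> \<Longrightarrow> content (r, c) \<le> d \<Longrightarrow>
    idx (T (r, c)) \<le> flag (T (Suc r, c))"
  by (simp add: tabs_def)

text \<open>The neighbour conditions chain to distant boxes: \<open>idx y \<le> Suc (flag y)\<close>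
  links them along rows, and \<open>flag y \<le> idx y\<close> along columns.\<close>

lemma colored_tableaux_eq_tabs:
  assumes "int wid - 1 \<le> d"
  shows "colored_tableaux N \<nu> = tabs d"
proof -
  have cont: "content b \<le> d" if "b \<in> diagram \<nu>" for b
    using diagram_bounds[of "fst b" "snd b"] that assms by (simp add: content_def)
  then have dom: "{b \<in> diagram \<nu>. content b \<le> d} = diagram \<nu>" by auto
  have cont': "content (r, c) \<le> d" if "(Suc r, c) \<in> diagram \<nu>" for r c
    using cont[of "(r, c)"] that by (auto simp: in_diagram)
  show ?thesis
  proof (intro Set.set_eqI iffI)
    fix T assume T: "T \<in> colored_tableaux N \<nu>"
    then have al: "1 \<le> idx (T b)" if "b \<in> diagram \<nu>" for b
      using that by (auto simp: colored_tableaux_def alphabet_iff dest: PiE_mem)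
    have "flag (T (r, c)) < idx (T (r, Suc c))" if "(r, Suc c) \<in> diagram \<nu>" for r c
    proof -
      have "(r, c) \<in> diagram \<nu>" using that col_antimono[of c "Suc c"] by (simp add: in_diagram)
      with T that show ?thesis
        by (subst row_condition[symmetric, OF al]) (auto simp: colored_tableaux_def)
    qed
    moreover have "idx (T (r, c)) \<le> flag (T (Suc r, c))" if "(Suc r, c) \<in> diagram \<nu>" for r c
    proof -
      have "(r, c) \<in> diagram \<nu>" using that by (simp add: in_diagram)
      with T that show ?thesis
        by (subst column_condition[symmetric, OF al]) (auto simp: colored_tableaux_def)
    qed
    ultimately show "T \<in> tabs d"
      using T unfolding tabs_def dom by (auto simp: colored_tableaux_def)
  next
    fix T assume T: "T \<in> tabs d"
    then have al: "1 \<le> idx (T (r, c))" if "(r, c) \<in> diagram \<nu>" for r c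
      using tabs_alphabet cont that by blast
    have row: "flag (T (r, c)) < idx (T (r, c'))" if "(r, c') \<in> diagram \<nu>" "c < c'" for r c c'
      using that
    proof (induction c')
      case (Suc k)
      have 1: "flag (T (r, k)) < idx (T (r, Suc k))" using Suc.prems tabs_row[OF T] cont by blast
      show ?case
      proof (cases "c = k")
        case False
        have "(r, k) \<in> diagram \<nu>" using Suc.prems col_antimono[of k "Suc k"] by (simp add: in_diagram)
        then have "flag (T (r, c)) < idx (T (r, k))" using Suc False by simp
        with 1 idx_le_flag[of "T (r, k)"] show ?thesis by simp
      qed (use 1 in simp)
    qed simp
    have column: "idx (T (r, c)) \<le> flag (T (r', c))" if "(r', c) \<in> diagram \<nu>" "r < r'" for r r' c
      using that
    proof (induction r')
      case (Suc k)
      have 1: "idx (T (k, c)) \<le> flag (T (Suc k, c))" using Suc.prems tabs_column[OF T] cont' by blast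
      show ?case
      proof (cases "r = k")
        case False
        then have "idx (T (r, c)) \<le> flag (T (k, c))" using Suc by (simp add: in_diagram)
        with 1 flag_le_idx[of "T (k, c)"] show ?thesis by simp
      qed (use 1 in simp)
    qed simp
    show "T \<in> colored_tableaux N \<nu>"
      unfolding colored_tableaux_def mem_Collect_eq
    proof (intro conjI[of "T \<in> _"] conjI[of "All _"] allI impI)
      show "T \<in> diagram \<nu> \<rightarrow>\<^sub>E alphabet N" using T unfolding tabs_def dom by simp
    next
      fix r c c' assume "(r, c) \<in> diagram \<nu> \<and> (r, c') \<in> diagram \<nu> \<and> c < c'"
      then show "T (r, c) \<le> T (r, c') \<and>
          (is_barred (T (r, c)) \<and> is_barred (T (r, c')) \<longrightarrow> T (r, c) < T (r, c'))"
        using row by (subst row_condition[OF al]) auto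
    next
      fix r r' c assume "(r, c) \<in> diagram \<nu> \<and> (r', c) \<in> diagram \<nu> \<and> r < r'"
      then show "T (r, c) \<le> T (r', c) \<and>
          (\<not> is_barred (T (r, c)) \<and> \<not> is_barred (T (r', c)) \<longrightarrow> T (r, c) < T (r', c))"
        using column by (subst column_condition[OF al]) auto
    qed
  qed
qed

section \<open>Adding one diagonal to a partial tableau\<close>

definition merge :: "int \<Rightarrow> (nat \<times> nat \<Rightarrow> letter) \<Rightarrow> (nat \<Rightarrow> letter) \<Rightarrow> nat \<times> nat \<Rightarrow> letter" where
  "merge d T z b = (if b \<in> diagram \<nu> \<and> content b = d then z (snd b) else T b)"

lemma merge_old: "content b < d \<Longrightarrow> merge d T z b = T b"
  by (simp add: merge_def)

lemma merge_new: "d \<le> int j \<Longrightarrow> j < diag_end d \<Longrightarrow> merge d T z (nat (int j - d), j) = z j"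
  by (simp add: merge_def in_diagram diag_end_iff content_def)

lemma colflag_le: "T \<in> tabs d \<Longrightarrow> colflag T d j \<le> N"
  using tabs_alphabet[of T d "nat (int j - d)" j] flag_le_idx[of "T (nat (int j - d), j)"]
  by (auto simp: colflag_def in_diagram content_def)

text \<open>Column \<open>j\<close> of diagonal \<open>d + 1\<close> and column \<open>j - 1\<close>
  of diagonal \<open>d\<close> meet these diagonals in the same row.\<close>

lemma lower_colflag:
  assumes "d + 1 \<le> int j" "j < diag_end (d + 1)"
  shows "lower (colflag T d) j = (if j = 0 then 0 else flag (T (nat (int j - (d + 1)), j - 1)))"
proof (cases j)
  case (Suc k)
  have "nat (int k - d) < col j" using assms by (simp add: diag_end_iff Suc)
  then have "nat (int k - d) < col k" using col_antimono[of k j] by (simp add: Suc)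
  then show ?thesis using assms by (simp add: Suc lower_def colflag_def)
qed (simp add: lower_def)

lemma colflag_diag:
  assumes "d + 1 \<le> int j"
  shows "colflag T d j = (if Suc (nat (int j - (d + 1))) < col j then flag (T (Suc (nat (int j - (d + 1))), j)) else N)"
proof -
  have "nat (int j - d) = Suc (nat (int j - (d + 1)))" using assms by simp
  then show ?thesis using assms by (simp add: colflag_def)
qed

lemma merge_in_tabs:
  assumes T: "T \<in> tabs d" and z: "z \<in> Pi\<^sub>E {nat (d + 1)..<diag_end (d + 1)} (choices (colflag T d))"
  shows "merge (d + 1) T z \<in> tabs (d + 1)"
proof -
  let ?T = "merge (d + 1) T z"
  have zc: "lower (colflag T d) c < idx (z c)" "idx (z c) \<le> colflag T d c" "?T (r, c) = z c"
    "d + 1 \<le> int c" "c < diag_end (d + 1)" "nat (int c - (d + 1)) = r"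
    if "(r, c) \<in> diagram \<nu>" "content (r, c) = d + 1" for r c
  proof -
    have c: "d + 1 \<le> int c" "nat (int c - (d + 1)) = r" using that by (auto simp: content_def)
    then show c': "c < diag_end (d + 1)" using that by (simp add: diag_end_iff in_diagram)
    with c PiE_mem[OF z, of c] show "lower (colflag T d) c < idx (z c)" "idx (z c) \<le> colflag T d c"
      by (auto simp: choices_def)
    show "?T (r, c) = z c" using that by (simp add: merge_def)
  qed (use that in \<open>auto simp: content_def\<close>)
  have "?T b \<in> alphabet N" if b: "b \<in> diagram \<nu>" "content b \<le> d + 1" for b
  proof (cases "content b = d + 1")
    case True
    obtain r c where rc: "b = (r, c)" by (cases b)
    show ?thesis
      using zc(1-3)[of r c] b True colflag_le[OF T, of c] unfolding rc alphabet_iff by simp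
  next
    case False
    then show ?thesis using b tabs_alphabet[OF T, of "fst b" "snd b"] by (simp add: merge_old alphabet_iff)
  qed
  moreover have "?T b = undefined" if "\<not> (b \<in> diagram \<nu> \<and> content b \<le> d + 1)" for b
    using that tabs_undefined[OF T, of b] by (auto simp: merge_def)
  moreover have "flag (?T (r, c)) < idx (?T (r, Suc c))"
    if b: "(r, Suc c) \<in> diagram \<nu>" "content (r, Suc c) \<le> d + 1" for r c
  proof -
    have old: "?T (r, c) = T (r, c)" using b by (intro merge_old) (simp add: content_def)
    show ?thesis
    proof (cases "content (r, Suc c) = d + 1")
      case True
      then show ?thesis using zc[OF b(1) True] lower_colflag[of d "Suc c" T] by (simp add: old)
    next
      case False
      then show ?thesis using b tabs_row[OF T b(1)] by (simp add: old merge_old)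
    qed
  qed
  moreover have "idx (?T (r, c)) \<le> flag (?T (Suc r, c))"
    if b: "(Suc r, c) \<in> diagram \<nu>" "content (r, c) \<le> d + 1" for r c
  proof -
    have rc: "(r, c) \<in> diagram \<nu>" using b by (simp add: in_diagram)
    have old: "?T (Suc r, c) = T (Suc r, c)" using b by (intro merge_old) (simp add: content_def)
    show ?thesis
    proof (cases "content (r, c) = d + 1")
      case True
      then show ?thesis using zc[OF rc True] colflag_diag[of d c T] b by (simp add: old in_diagram)
    next
      case False
      then show ?thesis using b tabs_column[OF T b(1)] by (simp add: old merge_old)
    qed
  qed
  ultimately show ?thesis unfolding tabs_def by (auto simp: PiE_def extensional_def Pi_def)
qed

text \<open>Boxes of one diagonal are never neighbours, so each condition on a new letter involves
  only old letters. The letters of the new diagonal can therefore be chosen independently.\<close>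

lemma sum_tabs_step:
  "(\<Sum>T\<in>tabs (d + 1). g T) =
   (\<Sum>T\<in>tabs d. \<Sum>z\<in>Pi\<^sub>E {nat (d + 1)..<diag_end (d + 1)} (choices (colflag T d)). g (merge (d + 1) T z))"
proof -
  let ?A = "{nat (d + 1)..<diag_end (d + 1)}"
  let ?B = "\<lambda>T. Pi\<^sub>E ?A (choices (colflag T d))"
  let ?D = "{b \<in> diagram \<nu>. content b \<le> d}"
  let ?i = "\<lambda>(T, z). merge (d + 1) T z"
  let ?j = "\<lambda>T. (restrict T ?D, restrict (\<lambda>j. T (nat (int j - (d + 1)), j)) ?A)"
  have A: "c \<in> ?A \<longleftrightarrow> d + 1 \<le> int c \<and> nat (int c - (d + 1)) < col c" for c
    unfolding diag_columns[symmetric] by simp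
  have "(\<Sum>T\<in>tabs (d + 1). g T) = (\<Sum>Tz\<in>Sigma (tabs d) ?B. g (?i Tz))"
  proof (rule sum.reindex_bij_witness[where i = ?i and j = ?j])
    fix T assume T: "T \<in> tabs (d + 1)"
    show ij: "?i (?j T) = T"
    proof (rule ext)
      fix b :: "nat \<times> nat"
      obtain r c where b: "b = (r, c)" by (cases b)
      consider "b \<notin> diagram \<nu> \<or> d + 1 < content b" | "b \<in> diagram \<nu>" "content b \<le> d" | "b \<in> diagram \<nu>" "content b = d + 1"
        by linarith
      then show "?i (?j T) b = T b"
      proof cases
        case 1
        then have "T b = undefined" by (intro tabs_undefined[OF T]) auto
        then show ?thesis using 1 by (auto simp: merge_def)
      next
        case 2 then show ?thesis by (simp add: merge_def)
      next
        case 3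
        then have "c \<in> ?A" "nat (int c - (d + 1)) = r"
          by (auto simp: A b content_def in_diagram simp del: atLeastLessThan_iff)
        then show ?thesis using 3 by (simp add: merge_def b del: atLeastLessThan_iff)
      qed
    qed
    then show "g (?i (?j T)) = g T" by simp
    let ?S = "restrict T ?D"
    have S: "?S (r, c) = T (r, c)" if "(r, c) \<in> diagram \<nu>" "content (r, c) \<le> d" for r c using that by simp
    have left: "(r, c) \<in> diagram \<nu>" if "(r, Suc c) \<in> diagram \<nu>" for r c
      using that col_antimono[of c "Suc c"] by (simp add: in_diagram)
    have up: "(r, c) \<in> diagram \<nu>" if "(Suc r, c) \<in> diagram \<nu>" for r c
      using that by (simp add: in_diagram)
    have "?S \<in> tabs d"
    proof -
      have "?S \<in> ?D \<rightarrow>\<^sub>E alphabet N" using T by (auto simp: tabs_def)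
      moreover have "flag (?S (r, c)) < idx (?S (r, Suc c))"
        if b: "(r, Suc c) \<in> diagram \<nu>" "content (r, Suc c) \<le> d" for r c
        using tabs_row[OF T b(1)] b left[OF b(1)] by (simp add: content_def)
      moreover have "idx (?S (r, c)) \<le> flag (?S (Suc r, c))"
        if b: "(Suc r, c) \<in> diagram \<nu>" "content (r, c) \<le> d" for r c
        using tabs_column[OF T b(1)] b up[OF b(1)] by (simp add: content_def)
      ultimately show ?thesis by (simp add: tabs_def)
    qed
    moreover have "T (nat (int c - (d + 1)), c) \<in> choices (colflag ?S d) c" if c: "c \<in> ?A" for c
    proof -
      let ?r = "nat (int c - (d + 1))"
      have c1: "d + 1 \<le> int c" "c < diag_end (d + 1)" and b: "(?r, c) \<in> diagram \<nu>" "content (?r, c) = d + 1"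
        using c A[of c] by (auto simp: in_diagram content_def)
      have "lower (colflag ?S d) c < idx (T (?r, c))"
      proof (cases c)
        case 0
        then show ?thesis using tabs_alphabet[OF T b(1)] b(2) c1 by (simp add: lower_def)
      next
        case (Suc k)
        have rk: "(?r, k) \<in> diagram \<nu>" "content (?r, k) = d"
          using left[of ?r k] b Suc by (auto simp: content_def)
        have "lower (colflag ?S d) c = flag (?S (?r, k))" using c1 by (subst lower_colflag) (auto simp: Suc)
        also have "?S (?r, k) = T (?r, k)" using rk by (intro S) auto
        finally have "lower (colflag ?S d) c = flag (T (?r, k))" .
        moreover have "flag (T (?r, k)) < idx (T (?r, c))" using tabs_row[OF T, of ?r k] b by (simp add: Suc)
        ultimately show ?thesis by (simp only:)
      qed
      moreover have "idx (T (?r, c)) \<le> colflag ?S d c"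
      proof (cases "Suc ?r < col c")
        case True
        then have "(Suc ?r, c) \<in> diagram \<nu>" by (simp add: in_diagram)
        moreover from this have "?S (Suc ?r, c) = T (Suc ?r, c)" using b by (intro S) (auto simp: content_def)
        ultimately show ?thesis
          using tabs_column[OF T, of ?r c] b True colflag_diag[OF c1(1), of ?S] by simp
      next
        case False
        then show ?thesis using tabs_alphabet[OF T b(1)] b(2) colflag_diag[OF c1(1), of ?S] by simp
      qed
      ultimately show ?thesis by (simp add: choices_def)
    qed
    ultimately show "?j T \<in> Sigma (tabs d) ?B" by auto
  next
    fix Tz assume "Tz \<in> Sigma (tabs d) ?B"
    then obtain T z where Tz: "Tz = (T, z)" and T: "T \<in> tabs d" and z: "z \<in> ?B T" by auto
    show "?i Tz \<in> tabs (d + 1)" using merge_in_tabs[OF T z] Tz by simp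
    have "restrict (merge (d + 1) T z) ?D = T"
      using tabs_undefined[OF T] by (auto simp: fun_eq_iff merge_def)
    moreover have "restrict (\<lambda>j. merge (d + 1) T z (nat (int j - (d + 1)), j)) ?A = z"
    proof (rule ext)
      fix j
      show "restrict (\<lambda>j. merge (d + 1) T z (nat (int j - (d + 1)), j)) ?A j = z j"
      proof (cases "j \<in> ?A")
        case True
        then have "d + 1 \<le> int j" "j < diag_end (d + 1)" by auto
        then show ?thesis using True merge_new[of "d + 1" j T z] by simp
      next
        case False
        then show ?thesis using z by (auto simp: PiE_def extensional_def)
      qed
    qed
    ultimately show "?j (?i Tz) = Tz" using Tz by simp
  qed
  also have "\<dots> = (\<Sum>T\<in>tabs d. \<Sum>z\<in>?B T. g (merge (d + 1) T z))"
    by (subst sum.Sigma) (auto simp: finite_tabs choices_def case_prod_unfold intro!: finite_PiE)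
  finally show ?thesis .
qed

definition sqread_upto :: "(nat \<times> nat \<Rightarrow> letter) \<Rightarrow> int \<Rightarrow> letter list" where
  "sqread_upto T d = concat (map (diag_word \<nu> T) [1 - int (length \<nu>)..d])"

lemma sqread_upto_merge:
  assumes "- int (length \<nu>) \<le> d"
  shows "sqread_upto (merge (d + 1) T z) (d + 1) = sqread_upto T d @
    filter (\<lambda>x. \<not> is_barred x) (map z (rev [nat (d + 1)..<diag_end (d + 1)])) @
    filter is_barred (map z [nat (d + 1)..<diag_end (d + 1)])"
proof -
  let ?T = "merge (d + 1) T z"
  have "[1 - int (length \<nu>)..d + 1] = [1 - int (length \<nu>)..d] @ [d + 1]"
    using assms by (subst upto_rec2) auto
  moreover have "map (diag_word \<nu> ?T) [1 - int (length \<nu>)..d] = map (diag_word \<nu> T) [1 - int (length \<nu>)..d]"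
  proof (rule map_cong[OF refl])
    fix d' assume d': "d' \<in> set [1 - int (length \<nu>)..d]"
    have "map ?T (diagonal \<nu> d') = map T (diagonal \<nu> d')"
      using d' by (auto simp: diagonal_def content_def intro!: merge_old)
    then show "diag_word \<nu> ?T d' = diag_word \<nu> T d'" by (simp only: diag_word_def)
  qed
  moreover have "map ?T (diagonal \<nu> (d + 1)) = map z [nat (d + 1)..<diag_end (d + 1)]"
    by (auto simp: diagonal_eq intro!: merge_new)
  then have "diag_word \<nu> ?T (d + 1) = filter (\<lambda>x. \<not> is_barred x) (map z (rev [nat (d + 1)..<diag_end (d + 1)])) @
      filter is_barred (map z [nat (d + 1)..<diag_end (d + 1)])"
    by (simp only: diag_word_def rev_map)
  ultimately show ?thesis by (simp only: sqread_upto_def map_append concat_append) simp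
qed

end

section \<open>Summation over all diagonals\<close>

lemma prod_list_filter:
  fixes u :: "'a \<Rightarrow> 'r::monoid_mult"
  shows "prod_list (map u (filter P xs)) = prod_list (map (\<lambda>x. if P x then u x else 1) xs)"
  by (induction xs) auto

lemma ncdet_identity: "ncdet t (\<lambda>k i. if i = k then 1 else 0) = (1 :: 'r::ring_1)"
proof -
  have "prod_list (map (\<lambda>j. if \<pi> j = j then 1 else 0) [0..<t]) = (0 :: 'r)"
    if p: "\<pi> permutes {0..<t}" and nid: "\<pi> \<noteq> id" for \<pi>
  proof -
    obtain k where k: "\<pi> k \<noteq> k" using nid by (auto simp: fun_eq_iff)
    then have "k < t" using permutes_not_in[OF p, of k] by fastforce
    with k show ?thesis by (simp add: prod_list_upt_split[of k])
  qed
  then have "ncdet t (\<lambda>k i. if i = k then 1 else 0) =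
      (\<Sum>\<pi> | \<pi> permutes {0..<t}. if \<pi> = id then 1 else (0 :: 'r))"
    unfolding ncdet_def by (intro sum.cong) (auto simp: prod_list_ones)
  also have "\<dots> = 1" by (simp add: finite_permutations permutes_id)
  finally show ?thesis .
qed

locale shape_letters = shape N \<nu> + kron_letters u
  for N :: nat and \<nu> :: "nat list" and u :: "letter \<Rightarrow> 'r::ring_1"
begin

definition J :: "int \<Rightarrow> (nat \<Rightarrow> nat) \<Rightarrow> 'r" where
  "J d f = ncdet wid (\<lambda>j i. e (f j) (beta d j + int i))"

lemma J_peel:
  assumes T: "T \<in> tabs d" and d: "d + 1 \<le> int wid"
  shows "J d (colflag T d) = (\<Sum>z\<in>Pi\<^sub>E {nat (d + 1)..<diag_end (d + 1)} (choices (colflag T d)).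
     prod_list (map (\<lambda>j. unb_part (z j)) (rev [nat (d + 1)..<diag_end (d + 1)])) *
     prod_list (map (\<lambda>j. bar_part (z j)) [nat (d + 1)..<diag_end (d + 1)]) *
     J (d + 1) (colflag (merge (d + 1) T z) (d + 1)))"
proof -
  let ?j0 = "nat (d + 1)" and ?j1 = "diag_end (d + 1)"
  have in_iff: "k < ?j1 \<longleftrightarrow> int k - d \<le> int (col k)" if "d + 1 \<le> int k" for k
    using diag_end_iff[OF that] that by auto
  interpret P: peeling u wid ?j0 ?j1 "beta d" "- d" "colflag T d"
  proof
    show "?j0 \<le> ?j1" by (rule nat_le_diag_end)
    show "?j1 \<le> wid" using d by (rule diag_end_le)
    fix k
    \<comment> \<open>A column meeting diagonal \<open>d + 1\<close> keeps exactly
      \<open>k - d\<close> boxes, and column \<open>d\<close> keeps none; in both cases subtracting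
      \<open>k\<close> leaves \<open>- d\<close>.\<close>
    show "beta d k = - d" if "?j0 \<le> Suc k" "k < ?j1"
    proof (cases "d + 1 \<le> int k")
      case True
      then show ?thesis using in_iff[of k] that by (simp add: beta_def)
    next
      case False
      then have "int k = d" using that by simp
      then show ?thesis by (simp add: beta_def)
    qed
    show "beta d k = - int k" if "k < ?j0" using that by (simp add: beta_def)
    show "beta d k \<le> - int ?j0" if "?j1 \<le> k" "0 < ?j0"
    proof -
      have "d + 1 \<le> int k" using that nat_le_diag_end[of "d + 1"] by simp
      then show ?thesis using that in_iff[of k] by (simp add: beta_def)
    qed
    show "colflag T d k = 0" if "Suc k < ?j0"
    proof -
      have "int k < d" using that by linarith
      then show ?thesis by (simp add: colflag_def)
    qed
    \<comment> \<open>The two boxes that give the flags are diagonal neighbours; they are compared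
      through the box below the first and left of the second.\<close>
    show "colflag T d k \<le> colflag T d (Suc k)" if k: "?j0 \<le> Suc k" "Suc k < ?j1"
    proof -
      let ?r = "nat (int k - d)"
      have c: "d + 1 \<le> int (Suc k)" "?r = nat (int (Suc k) - (d + 1))" using k by auto
      then have b: "(?r, Suc k) \<in> diagram \<nu>" using k by (simp add: diag_end_iff in_diagram)
      then have "?r < col k" using col_antimono[of k "Suc k"] unfolding in_diagram by linarith
      then have rk: "(?r, k) \<in> diagram \<nu>" by (simp only: in_diagram)
      have ck: "content (?r, k) \<le> d" using c(1) by (simp add: content_def)
      have fk: "colflag T d k = flag (T (?r, k))" 
        using c(1) \<open>?r < col k\<close> by (simp add: colflag_def)
      show ?thesis
      proof (cases "Suc ?r < col (Suc k)")
        case True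
        then have b': "(Suc ?r, Suc k) \<in> diagram \<nu>" "(Suc ?r, k) \<in> diagram \<nu>"
          using col_antimono[of k "Suc k"] by (auto simp: in_diagram)
        have "content (Suc ?r, Suc k) \<le> d" using c(1) by (simp add: content_def)
        then have "flag (T (Suc ?r, k)) < idx (T (Suc ?r, Suc k))" by (rule tabs_row[OF T b'(1)])
        moreover have "idx (T (?r, k)) \<le> flag (T (Suc ?r, k))" by (rule tabs_column[OF T b'(2) ck])
        moreover have "colflag T d (Suc k) = flag (T (Suc ?r, Suc k))"
          using colflag_diag[OF c(1), of T, folded c(2)] True by (simp only: if_True)
        ultimately show ?thesis
          using fk flag_le_idx[of "T (?r, k)"] idx_le_flag[of "T (Suc ?r, Suc k)"] by simp
      next
        case False
        then have "colflag T d (Suc k) = N" using colflag_diag[OF c(1), of T, folded c(2)] by (simp only: if_False)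
        then show ?thesis using colflag_le[OF T] by simp
      qed
    qed
  qed auto
  have "P.new_flag z k = colflag (merge (d + 1) T z) (d + 1) k" for z k
  proof -
    consider "k < ?j0" | "?j0 \<le> k" "k < ?j1" | "?j1 \<le> k" by linarith
    then show ?thesis
    proof cases
      case 1
      moreover from this have "int k < d + 1" by linarith
      ultimately show ?thesis by (simp add: P.new_flag_def colflag_def)
    next
      case 2
      then have c: "d + 1 \<le> int k" by simp
      then have "nat (int k - (d + 1)) < col k" using 2 by (simp add: diag_end_iff)
      then show ?thesis using 2 c merge_new[OF c 2(2), of T z] by (simp add: P.new_flag_def colflag_def)
    next
      case 3
      then have c: "d + 1 \<le> int k" using nat_le_diag_end[of "d + 1"] by simp
      then have "\<not> nat (int k - (d + 1)) < col k" using 3 diag_end_iff[OF c] by simp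
      then show ?thesis using 3 c P.j0_le by (auto simp: P.new_flag_def colflag_def)
    qed
  qed
  moreover have "P.new_beta k = beta (d + 1) k" for k
  proof (cases "d + 1 \<le> int k")
    case True
    then show ?thesis using in_iff[OF True] by (auto simp: P.new_beta_def beta_def)
  next
    case False
    then have "\<not> ?j0 \<le> k" by linarith
    then show ?thesis using False by (simp add: P.new_beta_def beta_def)
  qed
  moreover have "J d (colflag T d) = ncdet wid P.plain"
    unfolding J_def P.plain_def[abs_def] ..
  ultimately show ?thesis
    unfolding J_def using P.peel by simp
qed

text \<open>An invariant in \<open>d\<close>: it starts as the determinant of the whole shape and
  ends as the sum over all tableaux.\<close>

definition partial_sum :: "int \<Rightarrow> 'r" where
  "partial_sum d = (\<Sum>T\<in>tabs d. prod_list (map u (sqread_upto T d)) * J d (colflag T d))"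

lemma partial_sum_step:
  assumes d: "- int (length \<nu>) \<le> d" "d + 1 \<le> int wid"
  shows "partial_sum (d + 1) = partial_sum d"
proof -
  have "prod_list (map u (sqread_upto (merge (d + 1) T z) (d + 1))) = prod_list (map u (sqread_upto T d)) *
      (prod_list (map (\<lambda>j. unb_part (z j)) (rev [nat (d + 1)..<diag_end (d + 1)])) *
       prod_list (map (\<lambda>j. bar_part (z j)) [nat (d + 1)..<diag_end (d + 1)]))" for T z
    unfolding sqread_upto_merge[OF d(1)] map_append prod_list.append prod_list_filter
      unb_part_def[symmetric] bar_part_def[symmetric] map_map comp_def ..
  then show ?thesis
    unfolding partial_sum_def sum_tabs_step
    by (intro sum.cong refl) (simp add: J_peel[OF _ d(2)] sum_distrib_left mult.assoc)
qed

lemma partial_sum_first: "partial_sum (- int (length \<nu>)) = ncdet wid (\<lambda>j i. e N (int (col j) - int j + int i))"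
proof -
  let ?d = "- int (length \<nu>)"
  have cont: "\<not> content b \<le> ?d" if "b \<in> diagram \<nu>" for b
    using diagram_bounds[of "fst b" "snd b"] that by (simp add: content_def)
  have cont': "\<not> content (r, c) \<le> ?d" if "(Suc r, c) \<in> diagram \<nu>" for r c
    using diagram_bounds[of "Suc r" c] that by (simp add: content_def)
  have dom: "{b \<in> diagram \<nu>. content b \<le> ?d} = {}" using cont by blast
  have tabs: "tabs ?d = {\<lambda>_. undefined}"
    unfolding tabs_def dom PiE_empty_domain using cont cont' by blast
  have "colflag T ?d j = N" for T j
    using col_le_length[of j] by (auto simp: colflag_def)
  moreover have "beta ?d j = int (col j) - int j" for j
    using col_le_length[of j] by (auto simp: beta_def)
  ultimately show ?thesis by (simp add: partial_sum_def tabs sqread_upto_def J_def)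
qed

lemma partial_sum_last:
  assumes "int wid - 1 \<le> d"
  shows "partial_sum d = (\<Sum>T\<in>colored_tableaux N \<nu>. prod_list (map u (sqread_upto T d)))"
proof -
  have "J d f = 1" for f
  proof -
    have beta: "beta d k = - int k" if "k < wid" for k using that assms by (simp add: beta_def)
    have "J d f = ncdet wid (\<lambda>k i. if i = k then 1 else 0)"
      unfolding J_def by (rule ncdet_triangular[of wid]) (auto simp: beta esf_neg esf_zero)
    then show ?thesis by (simp add: ncdet_identity)
  qed
  then show ?thesis by (simp add: partial_sum_def colored_tableaux_eq_tabs[OF assms])
qed

lemma ncdet_eq_sum_tableaux:
  "ncdet wid (\<lambda>j i. e N (int (col j) + int i - int j)) =
   (\<Sum>T\<in>colored_tableaux N \<nu>. prod_list (map u (sqread \<nu> T)))"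
proof -
  \<comment> \<open>The maximum matters for the empty partition, where
    \<open>int wid - 1 = - 1\<close> lies below the starting value 0.\<close>
  define d1 where "d1 = max (int wid - 1) (- int (length \<nu>))"
  have "partial_sum d = partial_sum (- int (length \<nu>))" if "- int (length \<nu>) \<le> d" "d \<le> d1" for d
    using that
  proof (induction d rule: int_ge_induct)
    case (step d)
    then have "d + 1 \<le> int wid" by (auto simp: d1_def)
    then show ?case using step partial_sum_step[of d] by simp
  qed simp
  from this[of d1] have "partial_sum d1 = partial_sum (- int (length \<nu>))" by (simp add: d1_def)
  moreover have "sqread_upto T d1 = sqread \<nu> T" for T
  proof (cases "\<nu> = []")
    case True
    show ?thesis unfolding sqread_upto_def sqread_def d1_def by (simp add: True first_part_def)
  next
    case False
    then have "1 \<le> length \<nu>" by (simp add: Suc_le_eq)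
    then have "d1 = int wid - 1" by (simp add: d1_def)
    then show ?thesis by (simp add: sqread_upto_def sqread_def)
  qed
  ultimately show ?thesis
    using partial_sum_first partial_sum_last[of d1] by (simp add: d1_def algebra_simps)
qed

end

section \<open>The quotient algebra\<close>

lemma transp_succeq_col: "transp succeq_col"
  by (auto simp: succeq_col_def intro!: transpI)

definition col_words :: "nat \<Rightarrow> nat \<Rightarrow> letter list set" where
  "col_words i k = {w. w \<in> lists (alphabet i) \<and> length w = k \<and> successively succeq_col w}"

lemma finite_col_words: "finite (col_words i k)"
proof (rule finite_subset)
  show "col_words i k \<subseteq> {w. set w \<subseteq> alphabet i \<and> length w = k}"
    by (auto simp: col_words_def lists_eq_set)
  show "finite {w. set w \<subseteq> alphabet i \<and> length w = k}"
    by (rule finite_lists_length_eq) (simp add: alphabet_def)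
qed

lemma col_words_0: "col_words i 0 = {[]}"
  by (auto simp: col_words_def)

lemma Cons_col_words:
  "x # w \<in> col_words i (Suc k) \<longleftrightarrow> x \<in> alphabet i \<and> (\<forall>y\<in>set w. succeq_col x y) \<and> w \<in> col_words i k"
  by (auto simp: col_words_def successively_conv_sorted_wrt[OF transp_succeq_col])

lemma col_words_mono: "w \<in> col_words i k \<Longrightarrow> i \<le> j \<Longrightarrow> w \<in> col_words j k"
  by (auto simp: col_words_def alphabet_iff lists_eq_set)

lemma col_words_restrict: "w \<in> col_words j k \<Longrightarrow> (\<forall>y\<in>set w. idx y \<le> i) \<Longrightarrow> w \<in> col_words i k"
  by (auto simp: col_words_def alphabet_iff lists_eq_set)

lemma col_words_idx: "w \<in> col_words j k \<Longrightarrow> y \<in> set w \<Longrightarrow> 1 \<le> idx y \<and> idx y \<le> j"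
  by (auto simp: col_words_def alphabet_iff lists_eq_set)

lemma col_words_Suc:
  "col_words (Suc i) (Suc k) = col_words i (Suc k) \<union>
     ((#) (Unb (Suc i)) ` col_words i k \<union> (#) (Bar (Suc i)) ` col_words (Suc i) k)" (is "?L = ?R")
proof (intro Set.set_eqI iffI)
  fix w assume w: "w \<in> ?L"
  then obtain x v where xv: "w = x # v" by (cases w) (auto simp: col_words_def)
  have x: "x \<in> alphabet (Suc i)" "\<forall>y\<in>set v. succeq_col x y" "v \<in> col_words (Suc i) k"
    using w by (simp_all add: xv Cons_col_words)
  show "w \<in> ?R"
  proof (cases "idx x \<le> i")
    case True
    have "idx y \<le> i" if "succeq_col x y" for y
      using that True by (cases x; cases y) (auto simp: succeq_col_def less_letter_def)
    then have "w \<in> col_words i (Suc k)"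
      using w x True by (auto simp: xv intro!: col_words_restrict[of _ "Suc i"])
    then show ?thesis by simp
  next
    case False
    then have "idx x = Suc i" using x by (simp add: alphabet_iff)
    then consider "x = Unb (Suc i)" | "x = Bar (Suc i)" by (cases x) auto
    then show ?thesis
    proof cases
      case 1
      have "idx y \<le> i" if "succeq_col x y" for y
        using that 1 by (cases y) (auto simp: succeq_col_def less_letter_def)
      then have "v \<in> col_words i k" using x by (auto intro!: col_words_restrict[of _ "Suc i"])
      then show ?thesis using 1 by (simp add: xv)
    next
      case 2
      then show ?thesis using x by (simp add: xv)
    qed
  qed
next
  fix w assume "w \<in> ?R"
  then consider "w \<in> col_words i (Suc k)" | v where "w = Unb (Suc i) # v" "v \<in> col_words i k"
    | v where "w = Bar (Suc i) # v" "v \<in> col_words (Suc i) k" by auto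
  then show "w \<in> ?L"
  proof cases
    case 1
    then show ?thesis by (rule col_words_mono) simp
  next
    case 2
    have "succeq_col (Unb (Suc i)) y" if "y \<in> set v" for y
      using col_words_idx[OF 2(2) that] by (cases y) (auto simp: succeq_col_def less_letter_def)
    then show ?thesis
      using 2 by (auto simp: Cons_col_words alphabet_iff intro: col_words_mono)
  next
    case 3
    have "succeq_col (Bar (Suc i)) y" if "y \<in> set v" for y
      using col_words_idx[OF 3(2) that] by (cases y) (auto simp: succeq_col_def less_letter_def)
    then show ?thesis
      using 3 by (auto simp: Cons_col_words alphabet_iff)
  qed
qed

lemma esf_nat_eq_sum_words: "esf_nat u i k = (\<Sum>w\<in>col_words i k. prod_list (map u w))"
proof (induction u i k rule: esf_nat.induct)
  case (1 u k)
  have "col_words 0 k = (if k = 0 then {[]} else {})"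
    by (auto simp: col_words_def alphabet_def)
  then show ?case by simp
next
  case (2 u i)
  then show ?case by (simp add: col_words_0)
next
  case (3 u i k)
  let ?A = "(#) (Unb (Suc i)) ` col_words i k" and ?B = "(#) (Bar (Suc i)) ` col_words (Suc i) k"
  have disj: "col_words i (Suc k) \<inter> (?A \<union> ?B) = {}" "?A \<inter> ?B = {}"
    by (auto simp: Cons_col_words alphabet_iff)
  show ?case
    unfolding col_words_Suc
    by (simp add: sum.union_disjoint finite_col_words disj sum.reindex 3 sum_distrib_left add.assoc)
qed

section \<open>Truncation to a finite alphabet\<close>

definition trunc :: "nat \<Rightarrow> ncpoly \<Rightarrow> ncpoly" where
  "trunc N = frag_extend (\<lambda>w. if w \<in> lists (alphabet N) then word w else 0)"

lemma trunc_word: "trunc N (word w) = (if w \<in> lists (alphabet N) then word w else 0)"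
  by (simp add: trunc_def word_def)

lemma trunc_0 [simp]: "trunc N 0 = 0"
  by (simp add: trunc_def)

lemma trunc_add: "trunc N (p + q) = trunc N p + trunc N q"
  by (simp add: trunc_def frag_extend_add)

lemma trunc_diff: "trunc N (p - q) = trunc N p - trunc N q"
  by (simp add: trunc_def frag_extend_diff)

lemma ncpoly_induct [case_names zero word diff]:
  assumes "P 0" "\<And>w. P (word w)" "\<And>p q. P p \<Longrightarrow> P q \<Longrightarrow> P (p - q)"
  shows "P p"
  using assms by (intro frag_induction[of p UNIV P]) (auto simp: word_def)

text \<open>A concatenation is a word over the alphabet exactly when both factors are, so sending
  the other letters to 0 is multiplicative.\<close>

lemma trunc_mult: "trunc N (p * q) = trunc N p * trunc N q"
proof (induction p rule: ncpoly_induct)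
  case (word v)
  show ?case
    by (induction q rule: ncpoly_induct) (auto simp: word_mult trunc_word right_diff_distrib trunc_diff)
qed (simp_all add: left_diff_distrib trunc_diff)

lemma free_alg_diff: "p \<in> carrier (free_alg N) \<Longrightarrow> q \<in> carrier (free_alg N) \<Longrightarrow> p - q \<in> carrier (free_alg N)"
  using keys_diff[of p q] by (auto simp: free_alg_def)

lemma trunc_in_free_alg: "trunc N p \<in> carrier (free_alg N)"
proof (induction p rule: ncpoly_induct)
  case (word w)
  then show ?case by (simp add: trunc_word word_in_free_alg) (simp add: free_alg_def)
qed (simp_all add: trunc_diff free_alg_diff, simp add: free_alg_def)

lemma trunc_id: "p \<in> carrier (free_alg N) \<Longrightarrow> trunc N p = p"
proof -
  assume "p \<in> carrier (free_alg N)"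
  then have "Poly_Mapping.keys p \<subseteq> lists (alphabet N)" by (simp add: free_alg_def)
  then show ?thesis
    by (induction p rule: frag_induction) (simp_all add: trunc_diff trunc_word flip: word_def)
qed

lemma I_kron_zero: "0 \<in> I_kron N"
  using additive_subgroup.zero_closed[OF ideal.axioms(1)[OF ideal_I_kron[of N]]] by (simp add: free_alg_def)

lemma I_kron_add: "p \<in> I_kron N \<Longrightarrow> q \<in> I_kron N \<Longrightarrow> p + q \<in> I_kron N"
  using additive_subgroup.a_closed[OF ideal.axioms(1)[OF ideal_I_kron[of N]], of p q] by (simp add: free_alg_def)

lemma I_kron_mult_left: "p \<in> I_kron N \<Longrightarrow> q \<in> carrier (free_alg N) \<Longrightarrow> q * p \<in> I_kron N"
  using ideal.I_l_closed[OF ideal_I_kron[of N], of p q] by (simp add: free_alg_def)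

lemma I_kron_mult_right: "p \<in> I_kron N \<Longrightarrow> q \<in> carrier (free_alg N) \<Longrightarrow> p * q \<in> I_kron N"
  using ideal.I_r_closed[OF ideal_I_kron[of N], of p q] by (simp add: free_alg_def)

lemma I_kron_minus: "p \<in> I_kron N \<Longrightarrow> - p \<in> I_kron N"
proof -
  assume "p \<in> I_kron N"
  moreover have "- word [] \<in> carrier (free_alg N)" by (simp add: free_alg_def word_def)
  ultimately have "- word [] * p \<in> I_kron N" by (rule I_kron_mult_left)
  then show ?thesis by (simp add: word_Nil)
qed

text \<open>One quotient for all \<open>N\<close>, so that it is a type: a congruence only has to hold after each
  truncation, and truncation is the identity on \<open>free_alg N\<close>.\<close>

definition kron_rel :: "ncpoly \<Rightarrow> ncpoly \<Rightarrow> bool" where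
  "kron_rel p q \<longleftrightarrow> (\<forall>N. trunc N (p - q) \<in> I_kron N)"

lemma equivp_kron_rel: "equivp kron_rel"
proof (rule equivpI)
  show "reflp kron_rel" by (auto intro!: reflpI simp: kron_rel_def I_kron_zero)
  show "symp kron_rel"
  proof (rule sympI)
    fix p q assume "kron_rel p q"
    then have "- trunc N (p - q) \<in> I_kron N" for N by (simp add: kron_rel_def I_kron_minus)
    then show "kron_rel q p" by (simp add: kron_rel_def trunc_diff)
  qed
  show "transp kron_rel"
  proof (rule transpI)
    fix p q r assume "kron_rel p q" "kron_rel q r"
    then have "trunc N (p - q) + trunc N (q - r) \<in> I_kron N" for N
      by (simp add: kron_rel_def I_kron_add)
    then show "kron_rel p r" by (simp add: kron_rel_def trunc_diff)
  qed
qed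

lemma kron_rel_add: "kron_rel p p' \<Longrightarrow> kron_rel q q' \<Longrightarrow> kron_rel (p + q) (p' + q')"
proof -
  assume "kron_rel p p'" "kron_rel q q'"
  moreover have "p + q - (p' + q') = (p - p') + (q - q')" by simp
  ultimately show ?thesis unfolding kron_rel_def by (simp only: trunc_add I_kron_add simp_thms)
qed

lemma kron_rel_minus: "kron_rel p p' \<Longrightarrow> kron_rel (- p) (- p')"
proof -
  assume "kron_rel p p'"
  then have "kron_rel p' p" using equivp_kron_rel by (rule equivp_symp[rotated])
  then show ?thesis by (simp add: kron_rel_def)
qed

lemma kron_rel_mult: "kron_rel p p' \<Longrightarrow> kron_rel q q' \<Longrightarrow> kron_rel (p * q) (p' * q')"
proof -
  assume "kron_rel p p'" "kron_rel q q'"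
  then have "trunc N (p - p') * trunc N q + trunc N p' * trunc N (q - q') \<in> I_kron N" for N
    by (simp add: kron_rel_def I_kron_add I_kron_mult_left I_kron_mult_right trunc_in_free_alg)
  moreover have "p * q - p' * q' = (p - p') * q + p' * (q - q')" by (simp add: algebra_simps)
  ultimately show ?thesis by (simp only: kron_rel_def trunc_add trunc_mult) simp
qed

quotient_type kron_alg = ncpoly / kron_rel
  by (rule equivp_kron_rel)

instantiation kron_alg :: ring_1
begin

lift_definition zero_kron_alg :: kron_alg is 0 .
lift_definition one_kron_alg :: kron_alg is 1 .
lift_definition plus_kron_alg :: "kron_alg \<Rightarrow> kron_alg \<Rightarrow> kron_alg" is "(+)" by (rule kron_rel_add)
lift_definition uminus_kron_alg :: "kron_alg \<Rightarrow> kron_alg" is uminus by (rule kron_rel_minus)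
lift_definition minus_kron_alg :: "kron_alg \<Rightarrow> kron_alg \<Rightarrow> kron_alg" is "(-)"
  unfolding diff_conv_add_uminus by (intro kron_rel_add kron_rel_minus)
lift_definition times_kron_alg :: "kron_alg \<Rightarrow> kron_alg \<Rightarrow> kron_alg" is "(*)" by (rule kron_rel_mult)

instance
proof
  have refl: "kron_rel p p" for p using equivp_kron_rel by (rule equivp_reflp)
  fix a b c :: kron_alg
  show "a + b + c = a + (b + c)" by transfer (simp add: add.assoc refl)
  show "a + b = b + a" by transfer (simp add: add.commute refl)
  show "0 + a = a" by transfer (simp add: refl)
  show "- a + a = 0" by transfer (simp add: refl)
  show "a - b = a + - b" by transfer (simp add: refl)
  show "a * b * c = a * (b * c)" by transfer (simp add: mult.assoc refl)
  show "1 * a = a" "a * 1 = a" by (transfer, simp add: refl)+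
  show "(a + b) * c = a * c + b * c" by transfer (simp add: distrib_right refl)
  show "a * (b + c) = a * b + a * c" by transfer (simp add: distrib_left refl)
  \<comment> \<open>It suffices to look at \<open>N = 0\<close>: the alphabet is empty, there are no
    generators, and the ideal is zero.\<close>
  have "\<not> kron_rel 0 1"
  proof
    assume "kron_rel 0 1"
    then have "trunc 0 (0 - word []) \<in> I_kron 0" unfolding word_Nil[symmetric] kron_rel_def by blast
    then have "- word [] \<in> I_kron 0"
      using trunc_diff[of 0 0 "word []"] by (simp add: trunc_word)
    moreover have "I_kron 0 \<subseteq> {\<zero>\<^bsub>free_alg 0\<^esub>}"
      unfolding I_kron_def
      by (intro ring.genideal_minimal[OF ring_free_alg] ring.zeroideal[OF ring_free_alg])
        (auto simp: kron_gens_def alphabet_def)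
    ultimately show False by (auto simp: free_alg_def word_Nil)
  qed
  then show "(0 :: kron_alg) \<noteq> 1" by transfer
qed

end

section \<open>Passage to the quotient\<close>

definition to_alg :: "ncpoly \<Rightarrow> kron_alg" where "to_alg = abs_kron_alg"

lemma to_alg_eq_iff: "to_alg p = to_alg q \<longleftrightarrow> kron_rel p q"
  unfolding to_alg_def by (rule kron_alg.abs_eq_iff)

lemma to_alg_simps: "to_alg 0 = 0" "to_alg 1 = 1" "to_alg (p + q) = to_alg p + to_alg q"
  "to_alg (- p) = - to_alg p" "to_alg (p - q) = to_alg p - to_alg q" "to_alg (p * q) = to_alg p * to_alg q"
  by (simp_all add: to_alg_def zero_kron_alg.abs_eq one_kron_alg.abs_eq plus_kron_alg.abs_eq
    uminus_kron_alg.abs_eq minus_kron_alg.abs_eq times_kron_alg.abs_eq)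

lemma to_alg_sum: "to_alg (\<Sum>x\<in>A. f x) = (\<Sum>x\<in>A. to_alg (f x))"
  by (induction A rule: infinite_finite_induct) (simp_all add: to_alg_simps)

lemma to_alg_prod_list: "to_alg (prod_list xs) = prod_list (map to_alg xs)"
  by (induction xs) (simp_all add: to_alg_simps)

lemma to_alg_word: "to_alg (word w) = prod_list (map (\<lambda>x. to_alg (word [x])) w)"
proof (induction w)
  case (Cons x w)
  then show ?case by (simp add: word_mult[of "[x]" w, simplified, symmetric] to_alg_simps)
qed (simp add: word_Nil to_alg_simps)

text \<open>The type \<open>letter\<close> has two letters of index \<open>0\<close>, which lie in no alphabet. Sending them to \<open>0\<close> makes the
  relations hold for all letters.\<close>

definition gen :: "letter \<Rightarrow> kron_alg" where
  "gen x = (if idx x = 0 then 0 else to_alg (word [x]))"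

lemma to_alg_word_gen: "w \<in> lists (alphabet N) \<Longrightarrow> to_alg (word w) = prod_list (map gen w)"
proof -
  assume "w \<in> lists (alphabet N)"
  then have "map (\<lambda>x. to_alg (word [x])) w = map gen w"
    by (auto simp: gen_def alphabet_iff lists_eq_set)
  then show ?thesis by (subst to_alg_word) (rule arg_cong)
qed

text \<open>Both sides of a defining relation involve the same letters, so each truncation either
  keeps the relation intact or sends both sides to 0.\<close>

lemma kron_relI:
  assumes "\<And>N. trunc N p \<noteq> trunc N q \<Longrightarrow> trunc N p - trunc N q \<in> kron_gens N"
  shows "to_alg p = to_alg q"
  unfolding to_alg_eq_iff kron_rel_def trunc_diff
proof
  fix N
  show "trunc N p - trunc N q \<in> I_kron N"
  proof (cases "trunc N p = trunc N q")
    case True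
    then show ?thesis by (simp add: I_kron_zero)
  next
    case False
    then have "trunc N p - trunc N q \<in> kron_gens N" by (rule assms)
    then show ?thesis
      unfolding I_kron_def by (rule subsetD[OF ring.genideal_self[OF ring_free_alg kron_gens_carrier]])
  qed
qed

lemma gen_eqI:
  assumes "0 < idx x \<Longrightarrow> 0 < idx y \<Longrightarrow> to_alg (word [x, y]) = to_alg (word [y, x])"
  shows "gen x * gen y = gen y * gen x"
  using assms by (auto simp: gen_def word_mult simp flip: to_alg_simps(6))

lemma word2: "to_alg (word [x]) * to_alg (word [y]) = to_alg (word [x, y])"
  by (simp add: word_mult flip: to_alg_simps(6))

lemma word3: "to_alg (word [x]) * (to_alg (word [y]) * to_alg (word [z])) = to_alg (word [x, y, z])"
  by (simp add: word_mult flip: to_alg_simps(6))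

lemma kron_gensI:
  "x \<in> alphabet N \<Longrightarrow> y \<in> alphabet N \<Longrightarrow> \<not> is_barred y \<Longrightarrow> x < y \<Longrightarrow>
     word [y, y, x] - word [y, x, y] \<in> kron_gens N"
  "y \<in> alphabet N \<Longrightarrow> z \<in> alphabet N \<Longrightarrow> \<not> is_barred y \<Longrightarrow> y < z \<Longrightarrow>
     word [z, y, y] - word [y, z, y] \<in> kron_gens N"
  "y \<in> alphabet N \<Longrightarrow> z \<in> alphabet N \<Longrightarrow> is_barred y \<Longrightarrow> y < z \<Longrightarrow>
     word [y, y, z] - word [y, z, y] \<in> kron_gens N"
  "x \<in> alphabet N \<Longrightarrow> y \<in> alphabet N \<Longrightarrow> is_barred y \<Longrightarrow> x < y \<Longrightarrow>
     word [x, y, y] - word [y, x, y] \<in> kron_gens N"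
  "x \<in> alphabet N \<Longrightarrow> y \<in> alphabet N \<Longrightarrow> z \<in> alphabet N \<Longrightarrow> down y = Some x \<Longrightarrow> down2 z = Some x \<Longrightarrow>
     (word [x, z] - word [z, x]) * word [y] - word [y] * (word [x, z] - word [z, x]) \<in> kron_gens N"
  "x \<in> alphabet N \<Longrightarrow> z \<in> alphabet N \<Longrightarrow> down2 z = Some v \<Longrightarrow> x < v \<Longrightarrow>
     word [x, z] - word [z, x] \<in> kron_gens N"
  unfolding kron_gens_def
  subgoal by (rule UnI1, rule UnI1, rule UnI1, rule UnI1, rule UnI1) blast
  subgoal by (rule UnI1, rule UnI1, rule UnI1, rule UnI1, rule UnI2) blast
  subgoal by (rule UnI1, rule UnI1, rule UnI1, rule UnI2) blast
  subgoal by (rule UnI1, rule UnI1, rule UnI2) blast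
  subgoal by (rule UnI1, rule UnI2) blast
  subgoal by (rule UnI2) blast
  done

lemma kron_relations:
  "\<not> is_barred y \<Longrightarrow> x < y \<Longrightarrow> to_alg (word [y, y, x]) = to_alg (word [y, x, y])"
  "\<not> is_barred y \<Longrightarrow> y < z \<Longrightarrow> to_alg (word [z, y, y]) = to_alg (word [y, z, y])"
  "is_barred y \<Longrightarrow> y < z \<Longrightarrow> to_alg (word [y, y, z]) = to_alg (word [y, z, y])"
  "is_barred y \<Longrightarrow> x < y \<Longrightarrow> to_alg (word [x, y, y]) = to_alg (word [y, x, y])"
  "down2 z = Some v \<Longrightarrow> x < v \<Longrightarrow> to_alg (word [x, z]) = to_alg (word [z, x])"
  by (rule kron_relI, simp add: trunc_word kron_gensI split: if_splits)+

lemma kron_relation_near: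
  assumes "down y = Some x" "down2 z = Some x"
  shows "to_alg ((word [x, z] - word [z, x]) * word [y]) = to_alg (word [y] * (word [x, z] - word [z, x]))"
  using assms
  by (intro kron_relI)
    (simp add: trunc_word trunc_mult trunc_diff kron_gensI split: if_splits)

interpretation kron: kron_letters gen
proof
  show "gen (Unb 0) = 0" "gen (Bar 0) = 0" by (simp_all add: gen_def)
  fix x y z v :: letter
  show "gen y * (gen y * gen x) = gen y * (gen x * gen y)" if "\<not> is_barred y" "x < y"
    using kron_relations(1)[OF that] by (simp add: gen_def word3)
  show "gen z * (gen y * gen y) = gen y * (gen z * gen y)" if "\<not> is_barred y" "y < z"
    using kron_relations(2)[OF that] by (simp add: gen_def word3)
  show "gen y * (gen y * gen z) = gen y * (gen z * gen y)" if "is_barred y" "y < z"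
    using kron_relations(3)[OF that] by (simp add: gen_def word3)
  show "gen x * (gen y * gen y) = gen y * (gen x * gen y)" if "is_barred y" "x < y"
    using kron_relations(4)[OF that] by (simp add: gen_def word3)
  show "gen x * gen z = gen z * gen x" if "down2 z = Some v" "x < v"
    using kron_relations(5)[OF that] by (intro gen_eqI)
  show "(gen x * gen z - gen z * gen x) * gen y = gen y * (gen x * gen z - gen z * gen x)"
    if "down y = Some x" "down2 z = Some x"
    using kron_relation_near[OF that]
    by (simp add: gen_def to_alg_simps word2)
qed

lemma to_alg_e_nc: "to_alg (e_nc N k) = esf gen N k"
proof (cases "k < 0")
  case False
  have "to_alg (e_nc N k) = (\<Sum>w\<in>col_words N (nat k). to_alg (word w))"
    using False by (simp add: e_nc_def to_alg_sum col_words_def)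
  also have "\<dots> = (\<Sum>w\<in>col_words N (nat k). prod_list (map gen w))"
    by (intro sum.cong refl to_alg_word_gen[of _ N]) (simp add: col_words_def)
  finally show ?thesis using False by (simp add: esf_def esf_nat_eq_sum_words)
qed (simp add: e_nc_def esf_neg to_alg_simps)

lemma to_alg_of_int: "to_alg (of_int n) = of_int n"
proof (induction n rule: int_induct[where k = 0])
  case (step1 i)
  then show ?case by (simp add: to_alg_simps)
next
  case (step2 i)
  then show ?case by (simp add: to_alg_simps)
qed (simp add: to_alg_simps)

lemma to_alg_super_schur:
  "to_alg (super_schur N \<nu>) =
   ncdet (first_part \<nu>) (\<lambda>j i. esf gen N (int (conj_part \<nu> j) + int i - int j))"
  by (simp add: super_schur_def ncdet_def Let_def to_alg_sum to_alg_simps(6) to_alg_of_int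
    to_alg_prod_list comp_def to_alg_e_nc)

lemma sqread_in_lists:
  assumes "T \<in> colored_tableaux N \<nu>"
  shows "sqread \<nu> T \<in> lists (alphabet N)"
proof -
  have "T b \<in> alphabet N" if "b \<in> diagram \<nu>" for b
    using assms that by (auto simp: colored_tableaux_def dest: PiE_mem)
  then have "set (map T (diagonal \<nu> d)) \<subseteq> alphabet N" for d
    by (auto simp: diagonal_def)
  then have "set (diag_word \<nu> T d) \<subseteq> alphabet N" for d
    by (fastforce simp: diag_word_def)
  then show ?thesis by (auto simp: sqread_def lists_eq_set)
qed

lemma sum_in_free_alg:
  "(\<And>x. x \<in> A \<Longrightarrow> f x \<in> carrier (free_alg N)) \<Longrightarrow> (\<Sum>x\<in>A. f x) \<in> carrier (free_alg N)"
  using keys_sum[of f A] by (fastforce simp: free_alg_def)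

lemma mult_in_free_alg:
  "p \<in> carrier (free_alg N) \<Longrightarrow> q \<in> carrier (free_alg N) \<Longrightarrow> p * q \<in> carrier (free_alg N)"
  using monoid.m_closed[OF ring.is_monoid[OF ring_free_alg], of p N q] by (simp add: free_alg_def)

lemma one_in_free_alg: "1 \<in> carrier (free_alg N)"
  using word_in_free_alg[of "[]" N] by (simp add: word_Nil)

lemma e_nc_in_free_alg: "e_nc N k \<in> carrier (free_alg N)"
proof -
  have "0 \<in> carrier (free_alg N)" by (simp add: free_alg_def)
  then show ?thesis unfolding e_nc_def by (auto intro!: sum_in_free_alg word_in_free_alg)
qed

lemma super_schur_in_free_alg: "super_schur N \<nu> \<in> carrier (free_alg N)"
proof -
  have int: "of_int n \<in> carrier (free_alg N)" for n
    by (auto simp: free_alg_def keys_single zero_list_def simp flip: single_of_int)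
  have prod: "prod_list xs \<in> carrier (free_alg N)" if "set xs \<subseteq> carrier (free_alg N)" for xs
    using that by (induction xs) (simp_all add: one_in_free_alg mult_in_free_alg)
  show ?thesis
    unfolding super_schur_def Let_def
    by (intro sum_in_free_alg mult_in_free_alg int prod) (auto simp: e_nc_in_free_alg)
qed

theorem theorem2p3:
  fixes N :: nat and \<nu> :: "nat list"
  assumes "N \<ge> 1" and "is_partition \<nu>"
  shows "I_kron N +>\<^bsub>free_alg N\<^esub> super_schur N \<nu> =
         I_kron N +>\<^bsub>free_alg N\<^esub> (\<Sum>T\<in>colored_tableaux N \<nu>. word (sqread \<nu> T))"
proof -
  interpret shape_letters N \<nu> gen by unfold_locales (rule assms(2))
  let ?p = "super_schur N \<nu>" and ?q = "\<Sum>T\<in>colored_tableaux N \<nu>. word (sqread \<nu> T)"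
  have p: "?p \<in> carrier (free_alg N)" by (rule super_schur_in_free_alg)
  have q: "?q \<in> carrier (free_alg N)"
    by (intro sum_in_free_alg word_in_free_alg sqread_in_lists)
  have "to_alg ?p = to_alg ?q"
    unfolding to_alg_super_schur ncdet_eq_sum_tableaux to_alg_sum
    by (intro sum.cong refl to_alg_word_gen[symmetric] sqread_in_lists)
  then have "trunc N (?p - ?q) \<in> I_kron N" by (simp only: to_alg_eq_iff kron_rel_def)
  \<comment> \<open>Both elements lie in \<open>free_alg N\<close>, so the congruence at this
    \<open>N\<close> is membership of the untruncated difference in the ideal.\<close>
  then have diff: "?p - ?q \<in> I_kron N" using trunc_id[OF free_alg_diff[OF p q]] by simp
  interpret R: ring "free_alg N" by (rule ring_free_alg)
  have "\<ominus>\<^bsub>free_alg N\<^esub> ?q = - ?q"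
  proof (rule R.minus_equality)
    show "- ?q \<oplus>\<^bsub>free_alg N\<^esub> ?q = \<zero>\<^bsub>free_alg N\<^esub>" by (simp add: free_alg_def)
    show "- ?q \<in> carrier (free_alg N)" using q by (simp add: free_alg_def)
  qed (rule q)
  then have "?p \<ominus>\<^bsub>free_alg N\<^esub> ?q = ?p - ?q"
    by (simp add: a_minus_def) (simp add: free_alg_def)
  then show ?thesis
    using R.quotient_eq_iff_same_a_r_cos[OF ideal_I_kron p q] diff by simp
qed

end
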